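(* Let $f$ be a decay function with $F_\infty=\sum_{i=0}^\infty f_i<\infty$, where $f_i=f(i\Delta)$; let $\bar b$ be the maximum possible batch size; and let $C_k$ be the size at time $t_k=k\Delta$ of the sample maintained by the T-TBS scheme with decay function $f$, target size $n$, i.i.d. batch sizes with mean $b\in[n/F_\infty,\infty)$, and batch acceptance probability $q=n/(bF_\infty)$. Then: (i) for every integer $m\ge0$ there exists $k\ge0$ such that $\Pr[C_k\ge m]>0$; (ii) if $\bar b<\infty$ and $\sum_{i=0}^\infty i f_i<\infty$, then for every integer $m\ge0$, $\Pr[C_k=m\text{ for infinitely many }k]=1$; (iii) if $\bar b<\infty$ and there is a sequence $\{g_k\}_{k\ge0}$ with $\lim_{k\to\infty}g_k=0$ such that $\sup_{i\ge0}(f_{i+k}/f_i)\le g_k$ for all $k\ge1$, then (a) for every integer $m\ge0$, the expected times between successive visits of the process $\{C_k\}$ to the value $m$ are uniformly bounded (i.e., if $T_1<T_2<\cdots$ are the successive indices $k$ with $C_k=m$, then $\sup_{j\ge1}\mathbb{E}[T_{j+1}-T_j]<\infty$), and (b) $\lim_{k\to\infty}\frac1k\sum_{i=0}^kC_i=n$ with probability 1.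
   Context: Setting. Batches $\mathcal{B}_1,\mathcal{B}_2,\ldots$ are pairwise disjoint finite sets of items (possibly empty); $\mathcal{B}_k$ arrives at time $t_k=k\Delta$, where $\Delta>0$ is fixed. The batch sizes $|\mathcal{B}_k|$, $k\ge1$, are i.i.d. copies of a random variable $B$ with finite mean $b$. $\bar b\ge1$ denotes the maximum possible batch size, so that $\Pr[B\le\bar b]=1$ ($\bar b=\infty$ if $B$ is unbounded). Decay function. $f$ is a nonincreasing function on $[0,\infty)$ with $f(0)=1$ and $\lim_{\alpha\to\infty}f(\alpha)=0$, and $f_i=f(i\Delta)>0$ for all $i\ge0$. For $i\le k$ the age at time $t_k$ of an item of $\mathcal{B}_i$ is $\alpha_{i,k}=t_k-t_i=(k-i)\Delta$. T-TBS scheme. Let $n\ge1$ be the target sample size, $\gamma=1/F_\infty$, assume $b\ge n\gamma$, and set $q=n\gamma/b=n/(bF_\infty)\in(0,1]$. The sample is initially empty (so $C_0=0$). At each time $t_k$, $k\ge1$: (1) each item currently in the sample that arrived in batch $\mathcal{B}_i$ ($i<k$) is independently retained with probability $p_{i,k}=f(\alpha_{i,k})/f(\alpha_{i,k-1})$ and otherwise removed permanently; (2) each item of $\mathcal{B}_k$ is independently inserted into the sample with probability $q$. All these coin flips are mutually independent and independent of the batch sizes. $C_k$ denotes the number of items in the sample after processing $\mathcal{B}_k$.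
   Formalization: In (ii) and (iii)(a), if q=1 and batches are a.s. nonempty, "every m≥0" is restricted to m ≥ (minimum batch size)·#{i: f_i=1}; smaller values cannot recur (e.g. B=1, f_i=2^{-i}, n=2, m=0), so the printed claim fails there. *)

theory Defs
  imports "HOL-Probability.Probability"
begin

definition decay_function :: "real \<Rightarrow> (real \<Rightarrow> real) \<Rightarrow> bool" where
  "decay_function \<Delta> f \<longleftrightarrow>
     antimono_on {0..} f \<and> f 0 = 1 \<and> (f \<longlongrightarrow> 0) at_top \<and> (\<forall>i::nat. f (real i * \<Delta>) > 0)"

definition age :: "real \<Rightarrow> nat \<Rightarrow> nat \<Rightarrow> real" where
  "age \<Delta> i k = (real k - real i) * \<Delta>"

definition retention_prob :: "real \<Rightarrow> (real \<Rightarrow> real) \<Rightarrow> nat \<Rightarrow> nat \<Rightarrow> real" where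
  "retention_prob \<Delta> f i k = f (age \<Delta> i k) / f (age \<Delta> i (k - 1))"

text \<open>
  An item is a pair (i, j): the j-th item of the batch with index i, where j is smaller than the
  size of that batch.  Batches with different indices are therefore disjoint.
\<close>

type_synonym item = "nat \<times> nat"

definition batch :: "(nat \<Rightarrow> 'w \<Rightarrow> nat) \<Rightarrow> nat \<Rightarrow> 'w \<Rightarrow> item set" where
  "batch B k \<omega> = {k} \<times> {..<B k \<omega>}"

text \<open>
  The coin \<open>ins k j\<close> decides whether item (k, j) is inserted on arrival; the coin
  \<open>ret k i j\<close> decides whether item (i, j), if in the sample, is retained at step k.
\<close>

primrec sample ::
  "(nat \<Rightarrow> 'w \<Rightarrow> nat) \<Rightarrow> (nat \<Rightarrow> nat \<Rightarrow> 'w \<Rightarrow> bool) \<Rightarrow> (nat \<Rightarrow> nat \<Rightarrow> nat \<Rightarrow> 'w \<Rightarrow> bool) \<Rightarrow>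
   nat \<Rightarrow> 'w \<Rightarrow> item set" where
  "sample B ins ret 0 \<omega> = {}"
| "sample B ins ret (Suc k) \<omega> =
     {(i, j) \<in> sample B ins ret k \<omega>. ret (Suc k) i j \<omega>} \<union>
     {(i, j) \<in> batch B (Suc k) \<omega>. ins i j \<omega>}"

definition sample_size ::
  "(nat \<Rightarrow> 'w \<Rightarrow> nat) \<Rightarrow> (nat \<Rightarrow> nat \<Rightarrow> 'w \<Rightarrow> bool) \<Rightarrow> (nat \<Rightarrow> nat \<Rightarrow> nat \<Rightarrow> 'w \<Rightarrow> bool) \<Rightarrow>
   nat \<Rightarrow> 'w \<Rightarrow> nat" where
  "sample_size B ins ret k \<omega> = card (sample B ins ret k \<omega>)"

text \<open>
  All sources of randomness are collected in one family (coins coded as 0/1), so that a single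
  independence assumption covers the batch sizes and all coins jointly.
\<close>

datatype source = Size nat | Insertion nat nat | Retention nat nat nat

primrec source_value ::
  "(nat \<Rightarrow> 'w \<Rightarrow> nat) \<Rightarrow> (nat \<Rightarrow> nat \<Rightarrow> 'w \<Rightarrow> bool) \<Rightarrow> (nat \<Rightarrow> nat \<Rightarrow> nat \<Rightarrow> 'w \<Rightarrow> bool) \<Rightarrow>
   source \<Rightarrow> 'w \<Rightarrow> nat" where
  "source_value B ins ret (Size k) = B k"
| "source_value B ins ret (Insertion k j) = (\<lambda>\<omega>. of_bool (ins k j \<omega>))"
| "source_value B ins ret (Retention k i j) = (\<lambda>\<omega>. of_bool (ret k i j \<omega>))"

definition sources :: "source set" where
  "sources = {Size k | k. 1 \<le> k} \<union> {Insertion k j | k j. 1 \<le> k} \<union>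
             {Retention k i j | k i j. 1 \<le> i \<and> i < k}"

locale T_TBS = prob_space M for M :: "'w measure" +
  fixes \<Delta> :: real and f :: "real \<Rightarrow> real" and q :: real and D :: "nat pmf"
    and B :: "nat \<Rightarrow> 'w \<Rightarrow> nat"
    and ins :: "nat \<Rightarrow> nat \<Rightarrow> 'w \<Rightarrow> bool"
    and ret :: "nat \<Rightarrow> nat \<Rightarrow> nat \<Rightarrow> 'w \<Rightarrow> bool"
  assumes independent: "indep_vars (\<lambda>_. count_space UNIV) (source_value B ins ret) sources"
    and batch_size: "1 \<le> k \<Longrightarrow> distr M (count_space UNIV) (B k) = measure_pmf D"
    and insertion: "1 \<le> k \<Longrightarrow> \<P>(\<omega> in M. ins k j \<omega>) = q"
    and retention: "1 \<le> i \<Longrightarrow> i < k \<Longrightarrow> \<P>(\<omega> in M. ret k i j \<omega>) = retention_prob \<Delta> f i k"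

definition max_batch_size :: "nat pmf \<Rightarrow> enat" where
  "max_batch_size D = (SUP x\<in>set_pmf D. enat x)"

text \<open>
  If q < 1, or if batches can be empty, this is 0.  If q = 1 and every batch has at least
  \<open>\<beta> > 0\<close> items almost surely, then every item is inserted and is kept with
  certainty as long as the decay function equals 1 at its age; the sample then has at least
  \<open>\<beta>\<close> items for each such age once enough batches have arrived, and smaller
  values cannot recur.
\<close>

definition least_recurring_size :: "real \<Rightarrow> (real \<Rightarrow> real) \<Rightarrow> real \<Rightarrow> nat pmf \<Rightarrow> nat" where
  "least_recurring_size \<Delta> f q D =
     (if q < 1 then 0 else Inf (set_pmf D) * card {i::nat. f (real i * \<Delta>) = 1})"

text \<open>
  Indexing starts at 0: \<open>visit_time X m j\<close> is the (j + 1)-st index k with X k = m, and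
  \<open>\<infinity>\<close> if there are at most j such indices.  As \<open>\<infinity> - x = \<infinity>\<close> in
  \<^typ>\<open>enat\<close>, the time to a visit that does not take place is \<open>\<infinity>\<close>.
\<close>

primrec visit_time :: "(nat \<Rightarrow> nat) \<Rightarrow> nat \<Rightarrow> nat \<Rightarrow> enat" where
  "visit_time X m 0 = Inf {enat k | k. X k = m}"
| "visit_time X m (Suc j) = Inf {enat k | k. X k = m \<and> visit_time X m j < enat k}"

end

theory Submission
  imports Defs "HOL-Library.Discrete_Functions"
begin

text \<open>
  The items of batch \<open>i\<close> form a process depending only on the sources of that batch, so the
  contributions \<open>N i t\<close> of the batches to the sample size are independent; the mean of
  \<open>N i t\<close> is \<open>q b f(t - i)\<close>.  With probability at least \<open>1/2\<close> all but
  the last \<open>A\<close> batches are extinct, and independently of this the last \<open>A\<close> batches produce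
  exactly \<open>m\<close> items with positive probability.  Hence \<open>P(C k = m)\<close> is bounded away from 0, and
  since every batch dies out, Kolmogorov's 0-1 law gives infinitely many visits to \<open>m\<close>.  Under the uniform decay
  condition, items survive \<open>A\<close> further steps with uniformly small probability, whatever their age,
  while new arrivals add at most \<open>n\<close> in mean; a Foster-Lyapunov argument along times \<open>t + r A\<close>
  bounds the return time.  The sum \<open>C 0 + ... + C k\<close> is the sum over the batches of the total
  time spent by their items in the sample; these totals are independent with bounded second moments, so
  Chebyshev's inequality along \<open>k = r\<^sup>2\<close> and monotonicity give the strong law.
\<close>

section \<open>Sums, averages and visit times\<close>

text \<open>Instead, the estimates are made on an arbitrary event \<open>E\<close> of the past and
  are linear in the probability of \<open>E\<close>. This replaces conditioning, and such bounds can
  be summed over the possible values of a random visit time. A decay ratio that is uniform over all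
  ages lets the current size alone control the number of later survivors. Two sortings of the coins
  are used side by side: by batch, which gives independent contributions, and by time, which gives
  the history. The threshold \<open>least_recurring_size\<close> enters where the recent batches are
  made to produce exactly \<open>m\<close> items. An age with \<open>q * w a = 1\<close> keeps all
  of its items and must be charged with the least batch size, whereas any other age can be emptied
  with positive probability.\<close>

lemma of_nat_card_eq_suminf:
  assumes "\<And>j. P j \<Longrightarrow> j < m"
  shows "(of_nat (card {j. P j}) :: ennreal) = (\<Sum>j. of_bool (P j))"
proof -
  have "(\<Sum>j. of_bool (P j) :: ennreal) = (\<Sum>j<m. of_bool (P j))"
    using assms by (intro suminf_finite) auto
  also have "\<dots> = of_nat (card ({..<m} \<inter> {j. P j}))"
    by (simp add: of_bool_def sum.If_cases)
  also have "{..<m} \<inter> {j. P j} = {j. P j}"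
    using assms by auto
  finally show ?thesis ..
qed

text \<open>A nonzero natural number is at least 1, so the mean of \<open>X\<close> over
  \<open>E\<close> dominates the probability of the part of \<open>E\<close> where \<open>X\<close>
  does not vanish. Applied to the number of survivors of old batches, to show that they are often
  extinct.\<close>

lemma (in prob_space) prob_Int_eq_0_ge:
  fixes X :: "'a \<Rightarrow> nat"
  assumes [measurable]: "random_variable (count_space UNIV) X" "E \<in> events"
    and le: "(\<integral>\<^sup>+\<omega>. of_nat (X \<omega>) * indicator E \<omega> \<partial>M) \<le> ennreal c" and "0 \<le> c"
  shows "prob E - c \<le> prob (E \<inter> {\<omega> \<in> space M. X \<omega> = 0})"
proof -
  define Z where "Z = {\<omega> \<in> space M. X \<omega> = 0}"
  have [measurable]: "Z \<in> events" unfolding Z_def by measurable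
  have "ennreal (prob (E - Z)) = (\<integral>\<^sup>+\<omega>. indicator (E - Z) \<omega> \<partial>M)"
    by (simp add: emeasure_eq_measure)
  also have "\<dots> \<le> (\<integral>\<^sup>+\<omega>. of_nat (X \<omega>) * indicator E \<omega> \<partial>M)"
  proof (rule nn_integral_mono)
    fix \<omega> assume "\<omega> \<in> space M"
    then have "1 \<le> (of_nat (X \<omega>) :: ennreal)" if "\<omega> \<notin> Z"
      using that of_nat_mono[of 1 "X \<omega>", where 'a = ennreal] by (simp add: Z_def)
    then show "indicator (E - Z) \<omega> \<le> of_nat (X \<omega>) * (indicator E \<omega> :: ennreal)"
      by (simp add: indicator_def)
  qed
  finally have "prob (E - Z) \<le> c" using le \<open>0 \<le> c\<close> by (meson ennreal_le_iff order_trans)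
  moreover have "prob E = prob (E \<inter> Z) + prob (E - Z)"
    using finite_measure_Union[of "E \<inter> Z" "E - Z"] Int_Diff_Un[of E Z] Int_Diff_disjoint[of E Z] by simp
  ultimately show ?thesis by (simp add: Z_def)
qed

lemma sum_recent: "A \<le> t \<Longrightarrow> (\<Sum>i\<in>{t - A<..t}. g i) = (\<Sum>a<A. g (t - a))" for g :: "nat \<Rightarrow> 'b::comm_monoid_add"
  by (rule sum.reindex_bij_witness[of _ "\<lambda>a. t - a" "\<lambda>i. t - i"]) auto

text \<open>A finite value excludes the empty set, whose infimum is \<infinity>. The right-hand side
  inspects \<open>P\<close> only up to \<open>t\<close>, which is what makes visit times stopping
  times.\<close>

lemma Inf_enat_eq_iff: "Inf {enat k |k. P k} = enat t \<longleftrightarrow> P t \<and> (\<forall>s<t. \<not> P s)"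
proof
  assume *: "Inf {enat k |k. P k} = enat t"
  then have "{enat k |k. P k} \<noteq> {}" by (auto simp: Inf_enat_def split: if_splits)
  then have "Inf {enat k |k. P k} \<in> {enat k |k. P k}"
    unfolding Inf_enat_def by (auto intro: LeastI)
  then have "P t" using * by auto
  moreover have "\<not> P s" if "s < t" for s
  proof
    assume "P s"
    then have "Inf {enat k |k. P k} \<le> enat s" by (intro Inf_lower) auto
    then show False using * that by simp
  qed
  ultimately show "P t \<and> (\<forall>s<t. \<not> P s)" by blast
next
  assume "P t \<and> (\<forall>s<t. \<not> P s)"
  then show "Inf {enat k |k. P k} = enat t"
    by (intro antisym Inf_lower Inf_greatest) (auto simp: not_less[symmetric])
qed

lemma Inf_enat_neq_infinity: "P k \<Longrightarrow> Inf {enat k |k. P k} \<noteq> \<infinity>"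
  by (metis (mono_tags, lifting) Inf_lower enat_ord_simps(5) infinity_ileE mem_Collect_eq)

lemma less_enat_iff: "x < enat s \<longleftrightarrow> (\<exists>u<s. x = enat u)"
  by (cases x) auto

lemma visit_time_finite:
  assumes "\<exists>\<^sub>\<infinity>k. X k = m"
  shows "visit_time X m j \<noteq> \<infinity>"
proof (induction j)
  case 0
  obtain k where "X k = m" using assms INFM_EX by blast
  then show ?case
    unfolding visit_time.simps by (rule Inf_enat_neq_infinity[where P = "\<lambda>k. X k = m"])
next
  case (Suc j)
  then obtain u where u: "visit_time X m j = enat u" by auto
  obtain k where "u < k" "X k = m" using assms by (auto simp: INFM_nat)
  then have "X k = m \<and> visit_time X m j < enat k" using u by simp
  then show ?case
    unfolding visit_time.simps
    by (rule Inf_enat_neq_infinity[where P = "\<lambda>k. X k = m \<and> visit_time X m j < enat k"])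
qed

lemma visit_time_value: "visit_time X m j = enat t \<Longrightarrow> X t = m"
  by (cases j) (auto simp: Inf_enat_eq_iff)

lemma visit_time_Suc_le:
  assumes "visit_time X m j = enat t" "X (t + d) = m" "0 < d"
  shows "visit_time X m (Suc j) - visit_time X m j \<le> enat d"
proof -
  have "visit_time X m (Suc j) \<le> enat (t + d)"
    using assms by (auto intro!: Inf_lower)
  then show ?thesis
    using assms(1) by (cases "visit_time X m (Suc j)") auto
qed

text \<open>Expand the square and bound the earlier factor of each product by \<open>c\<close>: the
  term with index \<open>a\<close> then occurs at most \<open>2 * Suc a\<close> times. This trades a
  second moment for first moments weighted by age.\<close>

lemma square_sum_le:
  fixes x :: "nat \<Rightarrow> real"
  assumes "\<And>a. a < n \<Longrightarrow> 0 \<le> x a" "\<And>a. a < n \<Longrightarrow> x a \<le> c"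
  shows "(\<Sum>a<n. x a)\<^sup>2 \<le> 2 * c * (\<Sum>a<n. real (Suc a) * x a)"
  using assms
proof (induction n)
  case (Suc n)
  have "(\<Sum>a<n. x a) \<le> (\<Sum>a<n. c)" using Suc.prems by (intro sum_mono) auto
  then have "(\<Sum>a<n. x a) * x n \<le> (real n * c) * x n"
    using Suc.prems by (intro mult_right_mono) auto
  moreover have "x n * x n \<le> c * x n" using Suc.prems by (intro mult_right_mono) auto
  moreover have "0 \<le> c * x n" using Suc.prems[of n] by (meson mult_nonneg_nonneg lessI order_trans)
  moreover have "(\<Sum>a<n. x a)\<^sup>2 \<le> 2 * c * (\<Sum>a<n. real (Suc a) * x a)"
    using Suc by auto
  ultimately show ?case
    by (simp add: power2_eq_square algebra_simps)
qed simp

lemma sum_partial_sums: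
  fixes x :: "nat \<Rightarrow> real"
  shows "(\<Sum>j<k. \<Sum>a<Suc j. x a) = real k * (\<Sum>a<k. x a) - (\<Sum>a<k. real a * x a)"
  by (induction k) (simp_all add: algebra_simps)

lemma filterlim_floor_sqrt: "filterlim floor_sqrt at_top sequentially"
  unfolding filterlim_at_top eventually_sequentially by (meson le_floor_sqrt_iff)

text \<open>Consecutive squares have ratio tending to 1, so a monotone nonnegative sequence cannot
  move its average noticeably between them. The hypothesis starts at \<open>Suc r\<close>, which
  avoids the division by 0.\<close>

lemma tendsto_average_from_squares:
  fixes S :: "nat \<Rightarrow> real"
  assumes mono: "mono S" and nonneg: "\<And>k. 0 \<le> S k"
    and lim: "(\<lambda>r. S ((Suc r)\<^sup>2) / real ((Suc r)\<^sup>2)) \<longlonglongrightarrow> L"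
  shows "(\<lambda>k. S k / real k) \<longlonglongrightarrow> L"
proof -
  define h where "h r = S (r\<^sup>2) / real (r\<^sup>2)" for r
  have h: "h \<longlonglongrightarrow> L" using lim unfolding h_def by (rule LIMSEQ_imp_Suc)
  have "(\<lambda>r. (real r / real (Suc r))\<^sup>2) \<longlonglongrightarrow> 1\<^sup>2"
    by (intro tendsto_power LIMSEQ_n_over_Suc_n)
  then have lower: "(\<lambda>r. h r * (real r / real (Suc r))\<^sup>2) \<longlonglongrightarrow> L"
    using tendsto_mult[OF h] by fastforce
  have "(\<lambda>r. (real (Suc r) / real r)\<^sup>2) \<longlonglongrightarrow> 1\<^sup>2"
    by (intro tendsto_power LIMSEQ_Suc_n_over_n)
  then have upper: "(\<lambda>r. h (Suc r) * (real (Suc r) / real r)\<^sup>2) \<longlonglongrightarrow> L"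
    using tendsto_mult[OF h[THEN LIMSEQ_Suc]] by fastforce
  show ?thesis
  proof (rule tendsto_sandwich)
    show "(\<lambda>k. h (floor_sqrt k) * (real (floor_sqrt k) / real (Suc (floor_sqrt k)))\<^sup>2) \<longlonglongrightarrow> L"
      by (rule filterlim_compose[OF lower filterlim_floor_sqrt])
    show "(\<lambda>k. h (Suc (floor_sqrt k)) * (real (Suc (floor_sqrt k)) / real (floor_sqrt k))\<^sup>2) \<longlonglongrightarrow> L"
      by (rule filterlim_compose[OF upper filterlim_floor_sqrt])
    \<comment> \<open>Numerators are compared by monotonicity of \<open>S\<close>; replacing
      \<open>k\<close> by a neighbouring square in the denominator costs the factor
      \<open>(r / Suc r)\<^sup>2\<close> or its inverse.\<close>
    have *: "h r * (real r / real (Suc r))\<^sup>2 \<le> S k / real k \<and> S k / real k \<le> h (Suc r) * (real (Suc r) / real r)\<^sup>2"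
      if "0 < k" "r = floor_sqrt k" for k r
    proof
      have r: "0 < r" "r\<^sup>2 \<le> k" "k \<le> (Suc r)\<^sup>2"
        using that Suc_floor_sqrt_power2_gt[of k] by (auto intro: less_imp_le)
      then have S: "S (r\<^sup>2) \<le> S k" "S k \<le> S ((Suc r)\<^sup>2)" using mono by (auto dest: monoD)
      have r': "real (r\<^sup>2) \<le> real k" "real k \<le> real ((Suc r)\<^sup>2)" using r by (simp_all only: of_nat_le_iff)
      have "h r * (real r / real (Suc r))\<^sup>2 = S (r\<^sup>2) / real ((Suc r)\<^sup>2)"
        using r(1) by (simp add: h_def power_divide)
      also have "\<dots> \<le> S k / real k"
        using S nonneg r' that(1) by (intro frac_le) auto
      finally show "h r * (real r / real (Suc r))\<^sup>2 \<le> S k / real k" .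
      have "S k / real k \<le> S ((Suc r)\<^sup>2) / real (r\<^sup>2)"
        using S nonneg r' r(1) by (intro frac_le) auto
      also have "\<dots> = h (Suc r) * (real (Suc r) / real r)\<^sup>2"
        using r(1) by (simp add: h_def power_divide)
      finally show "S k / real k \<le> h (Suc r) * (real (Suc r) / real r)\<^sup>2" .
    qed
    show "\<forall>\<^sub>F k in sequentially. h (floor_sqrt k) * (real (floor_sqrt k) / real (Suc (floor_sqrt k)))\<^sup>2 \<le> S k / real k"
      using eventually_gt_at_top[of 0] by eventually_elim (use * in auto)
    show "\<forall>\<^sub>F k in sequentially. S k / real k \<le> h (Suc (floor_sqrt k)) * (real (Suc (floor_sqrt k)) / real (floor_sqrt k))\<^sup>2"
      using eventually_gt_at_top[of 0] by eventually_elim (use * in auto)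
  qed
qed

text \<open>After centring, the mixed products have mean 0, for which pairwise independence
  suffices; the remaining variances are at most the second moments.\<close>

lemma (in prob_space) second_moment_sum_centered_indep:
  fixes X :: "'i \<Rightarrow> 'a \<Rightarrow> real"
  assumes "finite I" and X: "\<And>i. i \<in> I \<Longrightarrow> integrable M (X i)"
    and X2: "\<And>i. i \<in> I \<Longrightarrow> integrable M (\<lambda>\<omega>. (X i \<omega>)\<^sup>2)"
    and indep: "\<And>i j. i \<in> I \<Longrightarrow> j \<in> I \<Longrightarrow> i \<noteq> j \<Longrightarrow> indep_var borel (X i) borel (X j)"
  shows "integrable M (\<lambda>\<omega>. ((\<Sum>i\<in>I. X i \<omega>) - (\<Sum>i\<in>I. expectation (X i)))\<^sup>2)" (is ?int)
    and "expectation (\<lambda>\<omega>. ((\<Sum>i\<in>I. X i \<omega>) - (\<Sum>i\<in>I. expectation (X i)))\<^sup>2) \<le> (\<Sum>i\<in>I. expectation (\<lambda>\<omega>. (X i \<omega>)\<^sup>2))" (is ?le)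
proof -
  define Y where "Y i \<omega> = X i \<omega> - expectation (X i)" for i \<omega>
  have Y: "integrable M (Y i)" "expectation (Y i) = 0" if "i \<in> I" for i
    using X[OF that] by (auto simp: Y_def[abs_def] prob_space)
  have Y2: "integrable M (\<lambda>\<omega>. (Y i \<omega>)\<^sup>2)" "expectation (\<lambda>\<omega>. (Y i \<omega>)\<^sup>2) \<le> expectation (\<lambda>\<omega>. (X i \<omega>)\<^sup>2)" if "i \<in> I" for i
  proof -
    show "integrable M (\<lambda>\<omega>. (Y i \<omega>)\<^sup>2)"
      unfolding Y_def power2_diff using X[OF that] X2[OF that] by auto
    show "expectation (\<lambda>\<omega>. (Y i \<omega>)\<^sup>2) \<le> expectation (\<lambda>\<omega>. (X i \<omega>)\<^sup>2)"
      unfolding Y_def using variance_eq[OF X[OF that] X2[OF that]] by simp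
  qed
  have YY: "integrable M (\<lambda>\<omega>. Y i \<omega> * Y j \<omega>) \<and>
      expectation (\<lambda>\<omega>. Y i \<omega> * Y j \<omega>) = (if i = j then expectation (\<lambda>\<omega>. (Y i \<omega>)\<^sup>2) else 0)"
    if "i \<in> I" "j \<in> I" for i j
  proof (cases "i = j")
    case True
    then show ?thesis using Y2(1)[OF that(1)] by (simp add: power2_eq_square)
  next
    case False
    have "indep_var borel (\<lambda>\<omega>. X i \<omega> - expectation (X i)) borel (\<lambda>\<omega>. X j \<omega> - expectation (X j))"
      using indep_var_compose[OF indep[OF that False], of "\<lambda>x. x - expectation (X i)" borel "\<lambda>x. x - expectation (X j)" borel]
      by (simp add: comp_def)
    then have "indep_var borel (Y i) borel (Y j)" by (simp add: Y_def[abs_def])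
    then show ?thesis
      using False Y that indep_var_lebesgue_integral[of "Y i" "Y j"] indep_var_integrable[of "Y i" "Y j"] by simp
  qed
  have eq: "((\<Sum>i\<in>I. X i \<omega>) - (\<Sum>i\<in>I. expectation (X i)))\<^sup>2 = (\<Sum>i\<in>I. \<Sum>j\<in>I. Y i \<omega> * Y j \<omega>)" for \<omega>
    by (simp add: Y_def power2_eq_square sum_product[symmetric] sum_subtractf)
  show ?int unfolding eq using YY by (intro Bochner_Integration.integrable_sum) auto
  have "expectation (\<lambda>\<omega>. \<Sum>i\<in>I. \<Sum>j\<in>I. Y i \<omega> * Y j \<omega>) = (\<Sum>i\<in>I. \<Sum>j\<in>I. expectation (\<lambda>\<omega>. Y i \<omega> * Y j \<omega>))"
    using YY by (subst Bochner_Integration.integral_sum, force)+ simp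
  also have "\<dots> = (\<Sum>i\<in>I. \<Sum>j\<in>I. if i = j then expectation (\<lambda>\<omega>. (Y i \<omega>)\<^sup>2) else 0)"
    using YY by (intro sum.cong refl) auto
  also have "\<dots> = (\<Sum>i\<in>I. expectation (\<lambda>\<omega>. (Y i \<omega>)\<^sup>2))"
    using \<open>finite I\<close> by simp
  also have "\<dots> \<le> (\<Sum>i\<in>I. expectation (\<lambda>\<omega>. (X i \<omega>)\<^sup>2))"
    by (intro sum_mono Y2)
  finally show ?le unfolding eq .
qed

lemma max_batch_size_finite:
  assumes "max_batch_size D < \<infinity>"
  obtains c where "\<forall>x\<in>set_pmf D. x \<le> c"
proof -
  obtain c where c: "max_batch_size D = enat c" using assms by auto
  have "x \<le> c" if "x \<in> set_pmf D" for x
    using SUP_upper[OF that, of enat] c by (simp add: max_batch_size_def)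
  then show thesis by (intro that) blast
qed

section \<open>Independence of the sources\<close>

text \<open>A retention coin is tossed at step \<open>k\<close> for an item of an earlier batch
  \<open>i\<close>, so the two sortings differ exactly on these coins: \<open>batch_of\<close>
  yields the independent blocks, \<open>time_of\<close> the history.\<close>

primrec batch_of :: "source \<Rightarrow> nat" where
  "batch_of (Size k) = k"
| "batch_of (Insertion k j) = k"
| "batch_of (Retention k i j) = i"

primrec time_of :: "source \<Rightarrow> nat" where
  "time_of (Size k) = k"
| "time_of (Insertion k j) = k"
| "time_of (Retention k i j) = k"

definition batch_sources :: "nat set \<Rightarrow> source set" where
  "batch_sources I = {s \<in> sources. batch_of s \<in> I}"

definition past_sources :: "nat \<Rightarrow> source set" where
  "past_sources t = {s \<in> sources. time_of s \<le> t}"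

lemma batch_of_le_time_of: "s \<in> sources \<Longrightarrow> batch_of s \<le> time_of s"
  by (auto simp: sources_def)

text \<open>A history up to \<open>t\<close> involves no batch after \<open>t\<close>; this is why
  past events are independent of later arrivals.\<close>

lemma past_sources_subset_batch: "past_sources t \<subseteq> batch_sources {..t}"
  using batch_of_le_time_of by (fastforce simp: past_sources_def batch_sources_def)

lemma in_sources_iff [simp]:
  "Size k \<in> sources \<longleftrightarrow> 1 \<le> k" "Insertion k j \<in> sources \<longleftrightarrow> 1 \<le> k"
  "Retention k i j \<in> sources \<longleftrightarrow> 1 \<le> i \<and> i < k"
  by (auto simp: sources_def)

text \<open>The consequences of the theorem's hypotheses from which the argument runs. The target
  size is no parameter here; it reappears as \<open>target\<close>, whose value is computed at the
  very end.\<close>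

locale decaying_sample = T_TBS M \<Delta> f q D B ins ret
  for M :: "'w measure" and \<Delta> f q D B ins ret +
  assumes step_pos: "\<Delta> > 0"
    and decay: "decay_function \<Delta> f"
    and q_pos: "0 < q" and q_le_1: "q \<le> 1"
    and w_summable: "summable (\<lambda>a. f (real a * \<Delta>))"
    and size_integrable: "integrable (measure_pmf D) real"
    and size_not_0: "\<exists>s\<in>set_pmf D. 0 < s"
begin

abbreviation w :: "nat \<Rightarrow> real" where
  "w a \<equiv> f (real a * \<Delta>)"

lemma w_0: "w 0 = 1" and w_pos: "0 < w a" and w_tendsto: "w \<longlonglongrightarrow> 0"
  and w_antimono: "a \<le> c \<Longrightarrow> w c \<le> w a" and w_le_1: "w a \<le> 1"
proof -
  show 0: "w 0 = 1" and "0 < w a"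
    using decay by (auto simp: decay_function_def)
  have "filterlim (\<lambda>a::nat. real a * \<Delta>) at_top sequentially"
    using step_pos by (intro filterlim_at_top_mult_tendsto_pos[OF tendsto_const] filterlim_real_sequentially) 
  then show "w \<longlonglongrightarrow> 0"
    using decay unfolding decay_function_def by (auto intro: filterlim_compose[of f])
  show mono: "w c \<le> w a" if "a \<le> c" for a c
    using decay step_pos that by (auto simp: decay_function_def monotone_on_def)
  show "w a \<le> 1" using mono[of 0 a] 0 by simp
qed

text \<open>The sigma-algebra generated by the sources in \<open>J\<close>. Membership of an event
  says that it depends on these sources only, so that independence questions become disjointness of
  index sets.\<close>

definition source_sigma :: "source set \<Rightarrow> 'w measure" where
  "source_sigma J = sigma (space M) {source_value B ins ret s -` A \<inter> space M |s A. s \<in> J}"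

lemma space_source_sigma [simp]: "space (source_sigma J) = space M"
  by (auto simp: source_sigma_def intro!: space_measure_of)

lemma sets_source_sigma:
  "sets (source_sigma J) = sigma_sets (space M) {source_value B ins ret s -` A \<inter> space M |s A. s \<in> J}"
  unfolding source_sigma_def by (intro sets_measure_of) auto

lemma source_sigma_mono: "J \<subseteq> K \<Longrightarrow> sets (source_sigma J) \<subseteq> sets (source_sigma K)"
  unfolding sets_source_sigma by (intro sigma_sets_mono') auto

lemma source_value_random:
  "s \<in> sources \<Longrightarrow> random_variable (count_space UNIV) (source_value B ins ret s)"
  using independent by (auto simp: indep_vars_def)

lemma source_sigma_events: "J \<subseteq> sources \<Longrightarrow> sets (source_sigma J) \<subseteq> events"
  unfolding sets_source_sigma
  by (intro sets.sigma_sets_subset) (auto intro!: measurable_sets[OF source_value_random])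

lemma source_value_measurable:
  "s \<in> J \<Longrightarrow> source_value B ins ret s \<in> measurable (source_sigma J) (count_space UNIV)"
  by (rule measurableI) (auto simp: sets_source_sigma intro!: sigma_sets.Basic)

lemma B_measurable: "Size i \<in> J \<Longrightarrow> B i \<in> measurable (source_sigma J) (count_space UNIV)"
  using source_value_measurable[of "Size i" J] by simp

lemma ins_measurable:
  assumes "Insertion i j \<in> J" shows "Measurable.pred (source_sigma J) (ins i j)"
proof -
  have "(\<lambda>\<omega>. source_value B ins ret (Insertion i j) \<omega> \<noteq> 0) \<in> measurable (source_sigma J) (count_space UNIV)"
    using source_value_measurable[OF assms] by measurable
  then show ?thesis by simp
qed

lemma ret_measurable:
  assumes "Retention k i j \<in> J" shows "Measurable.pred (source_sigma J) (ret k i j)"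
proof -
  have "(\<lambda>\<omega>. source_value B ins ret (Retention k i j) \<omega> \<noteq> 0) \<in> measurable (source_sigma J) (count_space UNIV)"
    using source_value_measurable[OF assms] by measurable
  then show ?thesis by simp
qed

text \<open>Grouping of independent variables: the preimages under one source are closed under
  intersection, so independence passes to the sigma-algebras generated by disjoint blocks.\<close>

lemma indep_sets_source_sigma:
  assumes "\<And>i. i \<in> I \<Longrightarrow> J i \<subseteq> sources" "disjoint_family_on J I"
  shows "indep_sets (\<lambda>i. sets (source_sigma (J i))) I"
proof -
  have "indep_sets (\<lambda>s. {source_value B ins ret s -` A \<inter> space M |A. A \<in> sets (count_space UNIV)}) sources"
    using independent unfolding indep_vars_def2 by simp
  then have "indep_sets (\<lambda>s. {source_value B ins ret s -` A \<inter> space M |A. A \<in> sets (count_space UNIV)}) (\<Union>i\<in>I. J i)"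
    by (rule indep_sets_mono_index[rotated]) (use assms in auto)
  then have "indep_sets (\<lambda>i. sigma_sets (space M)
      (\<Union>s\<in>J i. {source_value B ins ret s -` A \<inter> space M |A. A \<in> sets (count_space UNIV)})) I"
  proof (rule indep_sets_collect_sigma)
    fix s show "Int_stable {source_value B ins ret s -` A \<inter> space M |A. A \<in> sets (count_space UNIV)}"
    proof (rule Int_stableI)
      fix a b assume "a \<in> {source_value B ins ret s -` A \<inter> space M |A. A \<in> sets (count_space UNIV)}"
        "b \<in> {source_value B ins ret s -` A \<inter> space M |A. A \<in> sets (count_space UNIV)}"
      then obtain A A' where "a = source_value B ins ret s -` A \<inter> space M" "b = source_value B ins ret s -` A' \<inter> space M"
        by blast
      then have "a \<inter> b = source_value B ins ret s -` (A \<inter> A') \<inter> space M" by auto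
      then show "a \<inter> b \<in> {source_value B ins ret s -` A \<inter> space M |A. A \<in> sets (count_space UNIV)}"
        by (intro CollectI exI[of _ "A \<inter> A'"]) simp
    qed
  qed fact
  moreover have "(\<Union>s\<in>J i. {source_value B ins ret s -` A \<inter> space M |A. A \<in> sets (count_space UNIV)})
      = {source_value B ins ret s -` A \<inter> space M |s A. s \<in> J i}" for i
    by auto
  ultimately show ?thesis by (simp add: sets_source_sigma)
qed

lemma prob_Int_source_sigma:
  assumes "J \<subseteq> sources" "K \<subseteq> sources" "J \<inter> K = {}" "E \<in> sets (source_sigma J)" "E' \<in> sets (source_sigma K)"
  shows "prob (E \<inter> E') = prob E * prob E'"
proof -
  have "indep_sets (\<lambda>i. sets (source_sigma (case_bool J K i))) UNIV"
    using assms by (intro indep_sets_source_sigma) (auto simp: disjoint_family_on_def split: bool.split)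
  moreover have "(\<lambda>i. sets (source_sigma (case_bool J K i)))
      = case_bool (sets (source_sigma J)) (sets (source_sigma K))"
    by (auto split: bool.split simp: fun_eq_iff)
  ultimately have "indep_set (sets (source_sigma J)) (sets (source_sigma K))"
    by (simp add: indep_set_def)
  then show ?thesis using assms by (intro indep_setD)
qed

text \<open>Only coins are consulted, not whether the item exists: no bound by the batch size is
  imposed on \<open>j\<close>. Survival is therefore independent of the batch size.\<close>

definition alive :: "nat \<Rightarrow> nat \<Rightarrow> nat \<Rightarrow> 'w \<Rightarrow> bool" where
  "alive i j t \<omega> \<longleftrightarrow> ins i j \<omega> \<and> (\<forall>l\<in>{i<..t}. ret l i j \<omega>)"

definition N :: "nat \<Rightarrow> nat \<Rightarrow> 'w \<Rightarrow> nat" where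
  "N i t \<omega> = card {j. j < B i \<omega> \<and> alive i j t \<omega>}"

text \<open>Unrolling the recursion in time gives a description item by item, which can be regrouped
  by batch.\<close>

lemma sample_eq: "sample B ins ret t \<omega> = {(i, j). 1 \<le> i \<and> i \<le> t \<and> j < B i \<omega> \<and> alive i j t \<omega>}"
proof (induction t)
  case (Suc t)
  have *: "{i<..Suc t} = insert (Suc t) {i<..t}" if "i \<le> t" for i using that by auto
  show ?case
    unfolding sample.simps Suc by (auto simp: alive_def batch_def * le_Suc_eq)
qed auto

lemma sample_size_eq: "sample_size B ins ret t \<omega> = (\<Sum>i\<in>{1..t}. N i t \<omega>)"
proof -
  have "sample B ins ret t \<omega> = (SIGMA i:{1..t}. {j. j < B i \<omega> \<and> alive i j t \<omega>})"
    unfolding sample_eq by auto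
  then show ?thesis by (simp add: sample_size_def N_def)
qed

text \<open>\<open>Size i\<close> is left out, so that these sets are disjoint from it and, for
  different \<open>j\<close>, from each other.\<close>

definition item_sources :: "nat \<Rightarrow> nat \<Rightarrow> source set" where
  "item_sources i j = insert (Insertion i j) {Retention l i j |l. i < l}"

section \<open>Dependence of survival and batch contributions on the sources\<close>

lemma alive_measurable:
  assumes "Insertion i j \<in> J" "\<And>l. i < l \<Longrightarrow> l \<le> t \<Longrightarrow> Retention l i j \<in> J"
  shows "Measurable.pred (source_sigma J) (alive i j t)"
proof -
  have [measurable]: "Measurable.pred (source_sigma J) (ins i j)"
    using assms by (intro ins_measurable)
  have [measurable]: "l \<in> {i<..t} \<Longrightarrow> Measurable.pred (source_sigma J) (ret l i j)" for l
    using assms by (intro ret_measurable) auto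
  show ?thesis unfolding alive_def[abs_def] by measurable
qed

lemma N_measurable:
  assumes "{s \<in> sources. batch_of s = i \<and> time_of s \<le> t} \<subseteq> J" "1 \<le> i" "i \<le> t"
  shows "N i t \<in> measurable (source_sigma J) (count_space UNIV)"
proof -
  have [measurable]: "B i \<in> measurable (source_sigma J) (count_space UNIV)"
    using assms by (intro B_measurable subsetD[OF assms(1)]) auto
  have [measurable]: "Measurable.pred (source_sigma J) (alive i j t)" for j
    using assms by (intro alive_measurable subsetD[OF assms(1)]) auto
  show ?thesis unfolding N_def[abs_def] by measurable
qed

lemma N_measurable_batch:
  "i \<in> I \<Longrightarrow> 1 \<le> i \<Longrightarrow> i \<le> t \<Longrightarrow> N i t \<in> measurable (source_sigma (batch_sources I)) (count_space UNIV)"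
  by (rule N_measurable) (auto simp: batch_sources_def)

lemma N_measurable_past:
  "1 \<le> i \<Longrightarrow> i \<le> t \<Longrightarrow> t \<le> s \<Longrightarrow> N i t \<in> measurable (source_sigma (past_sources s)) (count_space UNIV)"
  by (rule N_measurable) (auto simp: past_sources_def)

lemma measurable_source_sigma_M:
  assumes "J \<subseteq> sources" "X \<in> measurable (source_sigma J) L" shows "X \<in> measurable M L"
  using measurable_sets[OF assms(2)] source_sigma_events[OF assms(1)] measurable_space[OF assms(2)]
  by (intro measurableI) auto

lemma batch_sources_subset: "batch_sources I \<subseteq> sources" and past_sources_subset: "past_sources t \<subseteq> sources"
  by (auto simp: batch_sources_def past_sources_def)

lemma B_rv [measurable]: "1 \<le> i \<Longrightarrow> random_variable (count_space UNIV) (B i)"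
  by (rule measurable_source_sigma_M[OF _ B_measurable[of i sources]]) auto

lemma alive_rv [measurable]: "1 \<le> i \<Longrightarrow> Measurable.pred M (alive i j t)"
  by (rule measurable_source_sigma_M[OF _ alive_measurable[of i j sources]]) auto

lemma N_rv [measurable]: "1 \<le> i \<Longrightarrow> i \<le> t \<Longrightarrow> random_variable (count_space UNIV) (N i t)"
  by (rule measurable_source_sigma_M[OF _ N_measurable[of i t sources]]) auto

lemma ret_prob: "1 \<le> i \<Longrightarrow> i \<le> l \<Longrightarrow> \<P>(\<omega> in M. ret (Suc l) i j \<omega>) = w (Suc l - i) / w (l - i)"
  using retention[of i "Suc l" j]
  by (simp add: retention_prob_def age_def Suc_diff_le of_nat_diff algebra_simps)

text \<open>The retention probabilities are successive quotients of decay values, so their product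
  telescopes to the quotient of the end values.\<close>

lemma prob_retained:
  assumes "1 \<le> i" "i \<le> k" "k \<le> t"
  shows "\<P>(\<omega> in M. \<forall>l\<in>{k<..t}. ret l i j \<omega>) = w (t - i) / w (k - i)"
  using \<open>k \<le> t\<close>
proof (induction t rule: dec_induct)
  case base
  then show ?case using w_pos[of "k - i"] by (simp add: prob_space)
next
  case (step t)
  let ?E = "{\<omega> \<in> space M. \<forall>l\<in>{k<..t}. ret l i j \<omega>}" and ?E' = "{\<omega> \<in> space M. ret (Suc t) i j \<omega>}"
  let ?J = "{Retention l i j |l. l \<in> {k<..t}}"
  have [measurable]: "l \<in> {k<..t} \<Longrightarrow> Measurable.pred (source_sigma ?J) (ret l i j)" for l
    by (intro ret_measurable) auto
  have [measurable]: "Measurable.pred (source_sigma {Retention (Suc t) i j}) (ret (Suc t) i j)"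
    by (intro ret_measurable) auto
  have "{\<omega> \<in> space (source_sigma ?J). \<forall>l\<in>{k<..t}. ret l i j \<omega>} \<in> sets (source_sigma ?J)"
    by measurable
  moreover have "{\<omega> \<in> space (source_sigma {Retention (Suc t) i j}). ret (Suc t) i j \<omega>} \<in> sets (source_sigma {Retention (Suc t) i j})"
    by measurable
  ultimately have "prob (?E \<inter> ?E') = prob ?E * prob ?E'"
    using assms step by (intro prob_Int_source_sigma[of ?J "{Retention (Suc t) i j}"]) auto
  moreover have "{\<omega> \<in> space M. \<forall>l\<in>{k<..Suc t}. ret l i j \<omega>} = ?E \<inter> ?E'"
    using step by (auto simp: le_Suc_eq)
  ultimately show ?case
    using step assms ret_prob[of i t j] w_pos[of "t - i"] by simp
qed

lemma prob_alive:
  assumes "1 \<le> i" "i \<le> t"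
  shows "\<P>(\<omega> in M. alive i j t \<omega>) = q * w (t - i)"
proof -
  let ?E = "{\<omega> \<in> space M. ins i j \<omega>}" and ?E' = "{\<omega> \<in> space M. \<forall>l\<in>{i<..t}. ret l i j \<omega>}"
  let ?J = "{Retention l i j |l. l \<in> {i<..t}}"
  have [measurable]: "l \<in> {i<..t} \<Longrightarrow> Measurable.pred (source_sigma ?J) (ret l i j)" for l
    by (intro ret_measurable) auto
  have [measurable]: "Measurable.pred (source_sigma {Insertion i j}) (ins i j)"
    by (intro ins_measurable) auto
  have "{\<omega> \<in> space (source_sigma ?J). \<forall>l\<in>{i<..t}. ret l i j \<omega>} \<in> sets (source_sigma ?J)"
    by measurable
  moreover have "{\<omega> \<in> space (source_sigma {Insertion i j}). ins i j \<omega>} \<in> sets (source_sigma {Insertion i j})"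
    by measurable
  ultimately have "prob (?E \<inter> ?E') = prob ?E * prob ?E'"
    using assms by (intro prob_Int_source_sigma[of "{Insertion i j}" ?J]) auto
  moreover have "{\<omega> \<in> space M. alive i j t \<omega>} = ?E \<inter> ?E'"
    by (auto simp: alive_def)
  ultimately show ?thesis
    using assms insertion[of i j] prob_retained[of i i t j] w_0 by simp
qed

section \<open>Mean numbers of surviving items\<close>

definition mean_size :: real where "mean_size = measure_pmf.expectation D real"

lemma mean_size_nonneg: "0 \<le> mean_size"
  by (simp add: mean_size_def)

text \<open>Counts become series of indicators over the items, so that means become sums of
  probabilities of single items. The factor \<open>indicator E\<close> carries the restriction to a
  past event along.\<close>

lemma of_nat_N_indicator:
  assumes "E \<subseteq> space M"
  shows "of_nat (N i t \<omega>) * indicator E \<omega> =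
    (\<Sum>j. indicator (E \<inter> {\<omega> \<in> space M. j < B i \<omega> \<and> alive i j t \<omega>}) \<omega> :: ennreal)"
  using assms unfolding N_def
  by (subst of_nat_card_eq_suminf[of _ "B i \<omega>"])
     (auto simp: indicator_def of_bool_def intro!: arg_cong[of _ _ suminf])

lemma nn_integral_N_indicator:
  assumes "1 \<le> i" and [measurable]: "E \<in> events"
  shows "(\<integral>\<^sup>+\<omega>. of_nat (N i t \<omega>) * indicator E \<omega> \<partial>M) =
    (\<Sum>j. ennreal (prob (E \<inter> {\<omega> \<in> space M. j < B i \<omega> \<and> alive i j t \<omega>})))"
proof -
  have [measurable]: "B i \<in> measurable M (count_space UNIV)" "\<And>j. Measurable.pred M (alive i j t)"
    using assms by (auto intro: B_rv alive_rv)
  have "(\<integral>\<^sup>+\<omega>. of_nat (N i t \<omega>) * indicator E \<omega> \<partial>M) =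
      (\<integral>\<^sup>+\<omega>. (\<Sum>j. indicator (E \<inter> {\<omega> \<in> space M. j < B i \<omega> \<and> alive i j t \<omega>}) \<omega>) \<partial>M)"
    using sets.sets_into_space[OF assms(2)] by (simp add: of_nat_N_indicator)
  also have "\<dots> = (\<Sum>j. emeasure M (E \<inter> {\<omega> \<in> space M. j < B i \<omega> \<and> alive i j t \<omega>}))"
    by (subst nn_integral_suminf) simp_all
  finally show ?thesis by (simp add: emeasure_eq_measure)
qed

text \<open>The tail-sum formula for the mean of a variable with natural values.\<close>

lemma suminf_prob_size:
  assumes "1 \<le> i"
  shows "(\<Sum>j. ennreal (\<P>(\<omega> in M. j < B i \<omega>))) = ennreal mean_size"
proof -
  note [measurable] = B_rv[OF assms]
  have "ennreal (\<P>(\<omega> in M. j < B i \<omega>)) = (\<integral>\<^sup>+\<omega>. of_bool (j < B i \<omega>) \<partial>M)" for j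
  proof -
    have "ennreal (\<P>(\<omega> in M. j < B i \<omega>)) = (\<integral>\<^sup>+\<omega>. indicator {\<omega> \<in> space M. j < B i \<omega>} \<omega> \<partial>M)"
      by (simp add: emeasure_eq_measure)
    also have "\<dots> = (\<integral>\<^sup>+\<omega>. of_bool (j < B i \<omega>) \<partial>M)"
      by (intro nn_integral_cong) (simp add: indicator_def)
    finally show ?thesis .
  qed
  then have "(\<Sum>j. ennreal (\<P>(\<omega> in M. j < B i \<omega>))) = (\<Sum>j. \<integral>\<^sup>+\<omega>. of_bool (j < B i \<omega>) \<partial>M)"
    by simp
  also have "\<dots> = (\<integral>\<^sup>+\<omega>. (\<Sum>j. of_bool (j < B i \<omega>)) \<partial>M)"
    by (subst nn_integral_suminf) simp_all
  also have "\<dots> = (\<integral>\<^sup>+\<omega>. of_nat (B i \<omega>) \<partial>M)"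
  proof (intro nn_integral_cong)
    fix \<omega> show "(\<Sum>j. of_bool (j < B i \<omega>)) = (of_nat (B i \<omega>) :: ennreal)"
      using of_nat_card_eq_suminf[of "\<lambda>j. j < B i \<omega>" "B i \<omega>"] by simp
  qed
  also have "\<dots> = (\<integral>\<^sup>+x. of_nat x \<partial>distr M (count_space UNIV) (B i))"
    by (subst nn_integral_distr) simp_all
  also have "\<dots> = (\<integral>\<^sup>+x. ennreal (real x) \<partial>measure_pmf D)"
    using batch_size[OF assms] by (simp add: ennreal_of_nat_eq_real_of_nat)
  also have "\<dots> = ennreal mean_size"
    unfolding mean_size_def by (rule nn_integral_eq_integral[OF size_integrable]) simp
  finally show ?thesis .
qed

text \<open>Three independent ingredients: the event \<open>E\<close>, the existence of item
  \<open>j\<close>, and its survival. Summing over \<open>j\<close> turns existence into the mean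
  batch size.\<close>

lemma nn_integral_N_later:
  assumes "J \<subseteq> sources" "J \<inter> batch_sources {i} = {}" "E \<in> sets (source_sigma J)" "1 \<le> i" "i \<le> t"
  shows "(\<integral>\<^sup>+\<omega>. of_nat (N i t \<omega>) * indicator E \<omega> \<partial>M) = ennreal (prob E * (q * mean_size * w (t - i)))"
proof -
  have *: "prob (E \<inter> {\<omega> \<in> space M. j < B i \<omega> \<and> alive i j t \<omega>}) =
      (prob E * (q * w (t - i))) * \<P>(\<omega> in M. j < B i \<omega>)" for j
  proof -
    let ?S = "{\<omega> \<in> space M. j < B i \<omega>}" and ?A = "{\<omega> \<in> space M. alive i j t \<omega>}"
    have [measurable]: "B i \<in> measurable (source_sigma {Size i}) (count_space UNIV)"
      "B i \<in> measurable (source_sigma (batch_sources {i})) (count_space UNIV)"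
      using assms by (auto intro!: B_measurable simp: batch_sources_def)
    have [measurable]: "Measurable.pred (source_sigma (item_sources i j)) (alive i j t)"
      "Measurable.pred (source_sigma (batch_sources {i})) (alive i j t)"
      using assms by (auto intro!: alive_measurable simp: batch_sources_def item_sources_def)
    have "{\<omega> \<in> space (source_sigma {Size i}). j < B i \<omega>} \<in> sets (source_sigma {Size i})"
      "{\<omega> \<in> space (source_sigma (item_sources i j)). alive i j t \<omega>} \<in> sets (source_sigma (item_sources i j))"
      by measurable
    then have "prob (?S \<inter> ?A) = prob ?S * prob ?A"
      using assms by (intro prob_Int_source_sigma[of "{Size i}" "item_sources i j"]) (auto simp: item_sources_def)
    moreover have *: "{\<omega> \<in> space M. j < B i \<omega> \<and> alive i j t \<omega>} = ?S \<inter> ?A" by auto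
    moreover have "{\<omega> \<in> space (source_sigma (batch_sources {i})). j < B i \<omega> \<and> alive i j t \<omega>}
        \<in> sets (source_sigma (batch_sources {i}))"
      by measurable
    then have "prob (E \<inter> (?S \<inter> ?A)) = prob E * prob (?S \<inter> ?A)"
      using assms * by (intro prob_Int_source_sigma[of J "batch_sources {i}"]) (auto simp: batch_sources_subset)
    ultimately show ?thesis
      using prob_alive[of i t j] assms by (simp add: mult_ac)
  qed
  have E: "E \<in> events" using assms source_sigma_events by auto
  have "(\<integral>\<^sup>+\<omega>. of_nat (N i t \<omega>) * indicator E \<omega> \<partial>M)
      = (\<Sum>j. ennreal (prob E * (q * w (t - i))) * ennreal (\<P>(\<omega> in M. j < B i \<omega>)))"
    using q_pos w_pos[of "t - i"]
    by (simp add: nn_integral_N_indicator[OF \<open>1 \<le> i\<close> E] * ennreal_mult')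
  also have "\<dots> = ennreal (prob E * (q * w (t - i))) * ennreal mean_size"
    by (simp add: suminf_prob_size[OF \<open>1 \<le> i\<close>])
  finally show ?thesis
    using q_pos w_pos[of "t - i"] mean_size_nonneg by (simp add: ennreal_mult'[symmetric] mult_ac)
qed

lemma nn_integral_N:
  assumes "1 \<le> i" "i \<le> t"
  shows "(\<integral>\<^sup>+\<omega>. of_nat (N i t \<omega>) \<partial>M) = ennreal (q * mean_size * w (t - i))"
proof -
  \<comment> \<open>The whole space depends on no source, so the empty index set gives the
    unrestricted mean.\<close>
  have "space M \<in> sets (source_sigma {})"
    using sets.top[of "source_sigma {}"] by simp
  from nn_integral_N_later[OF _ _ this assms] have
    "(\<integral>\<^sup>+\<omega>. of_nat (N i t \<omega>) * indicator (space M) \<omega> \<partial>M) = ennreal (q * mean_size * w (t - i))"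
    by (simp add: prob_space)
  then show ?thesis
    by (simp cong: nn_integral_cong_simp)
qed

text \<open>The coins tossed after \<open>k\<close> are independent of the history, and every item
  of batch \<open>i\<close> present at \<open>k\<close> survives until \<open>t\<close> with the
  same probability, which factors out of the sum over items.\<close>

lemma nn_integral_N_survive:
  assumes "E \<in> sets (source_sigma (past_sources k))" "1 \<le> i" "i \<le> k" "k \<le> t"
  shows "(\<integral>\<^sup>+\<omega>. of_nat (N i t \<omega>) * indicator E \<omega> \<partial>M) =
    ennreal (w (t - i) / w (k - i)) * (\<integral>\<^sup>+\<omega>. of_nat (N i k \<omega>) * indicator E \<omega> \<partial>M)"
proof -
  have *: "prob (E \<inter> {\<omega> \<in> space M. j < B i \<omega> \<and> alive i j t \<omega>}) =
      (w (t - i) / w (k - i)) * prob (E \<inter> {\<omega> \<in> space M. j < B i \<omega> \<and> alive i j k \<omega>})" for j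
  proof -
    let ?K = "{Retention l i j |l. l \<in> {k<..t}}"
    let ?R = "{\<omega> \<in> space M. \<forall>l\<in>{k<..t}. ret l i j \<omega>}"
    let ?S = "{\<omega> \<in> space M. j < B i \<omega> \<and> alive i j k \<omega>}"
    have [measurable]: "B i \<in> measurable (source_sigma (past_sources k)) (count_space UNIV)"
      "Measurable.pred (source_sigma (past_sources k)) (alive i j k)"
      using assms by (auto intro!: B_measurable alive_measurable simp: past_sources_def)
    have [measurable]: "l \<in> {k<..t} \<Longrightarrow> Measurable.pred (source_sigma ?K) (ret l i j)" for l
      by (intro ret_measurable) auto
    have "{\<omega> \<in> space (source_sigma (past_sources k)). j < B i \<omega> \<and> alive i j k \<omega>} \<in> sets (source_sigma (past_sources k))"
      by measurable
    moreover have "{\<omega> \<in> space (source_sigma ?K). \<forall>l\<in>{k<..t}. ret l i j \<omega>} \<in> sets (source_sigma ?K)"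
      by measurable
    ultimately have "prob ((E \<inter> ?S) \<inter> ?R) = prob (E \<inter> ?S) * prob ?R"
      using assms by (intro prob_Int_source_sigma[of "past_sources k" ?K]) (auto simp: past_sources_def)
    moreover have "{i<..t} = {i<..k} \<union> {k<..t}" using assms by auto
    then have "E \<inter> {\<omega> \<in> space M. j < B i \<omega> \<and> alive i j t \<omega>} = (E \<inter> ?S) \<inter> ?R"
      by (auto simp: alive_def)
    ultimately show ?thesis
      using prob_retained[of i k t j] assms by (simp add: mult_ac)
  qed
  have E: "E \<in> events" using assms source_sigma_events[OF past_sources_subset] by auto
  have "0 \<le> w (t - i) / w (k - i)"
    using w_pos[of "t - i"] w_pos[of "k - i"] by simp
  then show ?thesis
    unfolding nn_integral_N_indicator[OF \<open>1 \<le> i\<close> E] * by (subst ennreal_mult') simp_all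
qed

section \<open>The recent batches\<close>

lemma prob_size:
  assumes "1 \<le> i" shows "\<P>(\<omega> in M. B i \<omega> = s) = pmf D s"
proof -
  have "prob (B i -` {s} \<inter> space M) = measure (measure_pmf D) {s}"
    using measure_distr[OF B_rv[OF assms], of "{s}"] batch_size[OF assms] by simp
  then show ?thesis
    by (simp add: measure_pmf_single vimage_def Int_def conj_commute)
qed

text \<open>One configuration is enough: the batch has exactly \<open>s\<close> items, of which the
  first \<open>v\<close> survive and the others do not. Hence no binomial coefficient.\<close>

lemma prob_N_ge:
  assumes "1 \<le> i" "i \<le> t" "v \<le> s"
  shows "pmf D s * ((q * w (t - i)) ^ v * (1 - q * w (t - i)) ^ (s - v)) \<le> \<P>(\<omega> in M. N i t \<omega> = v)"
proof -
  \<comment> \<open>The index \<open>None\<close> stands for the batch size and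
    \<open>Some j\<close> for item \<open>j\<close>, so that one product formula covers both kinds
    of events.\<close>
  define J where "J = case_option {Size i} (item_sources i)"
  define E where "E = case_option {\<omega> \<in> space M. B i \<omega> = s} (\<lambda>j. {\<omega> \<in> space M. alive i j t \<omega> \<longleftrightarrow> j < v})"
  define I where "I = insert None (Some ` {..<s})"
  note [measurable] = B_rv[OF \<open>1 \<le> i\<close>] alive_rv[OF \<open>1 \<le> i\<close>] N_rv[OF assms(1,2)]
  have indep: "indep_sets (\<lambda>x. sets (source_sigma (J x))) UNIV"
    using assms by (intro indep_sets_source_sigma)
      (auto simp: J_def disjoint_family_on_def item_sources_def split: option.splits)
  have mem: "E x \<in> sets (source_sigma (J x))" for x
  proof (cases x)
    case None
    have [measurable]: "B i \<in> measurable (source_sigma {Size i}) (count_space UNIV)"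
      by (rule B_measurable) simp
    have "{\<omega> \<in> space (source_sigma {Size i}). B i \<omega> = s} \<in> sets (source_sigma {Size i})" by measurable
    then show ?thesis using None by (simp add: J_def E_def)
  next
    case (Some j)
    have [measurable]: "Measurable.pred (source_sigma (item_sources i j)) (alive i j t)"
      by (rule alive_measurable) (auto simp: item_sources_def)
    have "{\<omega> \<in> space (source_sigma (item_sources i j)). alive i j t \<omega> \<longleftrightarrow> j < v} \<in> sets (source_sigma (item_sources i j))"
      by measurable
    then show ?thesis using Some by (simp only: J_def E_def option.case space_source_sigma)
  qed
  have "prob (\<Inter>x\<in>I. E x) = (\<Prod>x\<in>I. prob (E x))"
  proof (rule indep_setsD[OF indep])
    show "\<forall>x\<in>I. E x \<in> sets (source_sigma (J x))" using mem by blast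
  qed (simp_all add: I_def)
  also have "\<dots> = pmf D s * (\<Prod>j<s. \<P>(\<omega> in M. alive i j t \<omega> \<longleftrightarrow> j < v))"
    unfolding I_def by (subst prod.insert) (auto simp: E_def prod.reindex prob_size[OF assms(1)])
  also have "(\<Prod>j<s. \<P>(\<omega> in M. alive i j t \<omega> \<longleftrightarrow> j < v)) =
      (\<Prod>j<s. if j < v then q * w (t - i) else 1 - q * w (t - i))"
  proof (intro prod.cong refl)
    fix j
    have "{\<omega> \<in> space M. alive i j t \<omega>} \<in> events" by measurable
    then have "\<P>(\<omega> in M. \<not> alive i j t \<omega>) = 1 - q * w (t - i)"
      by (simp only: prob_neg prob_alive[OF assms(1,2)])
    then show "\<P>(\<omega> in M. alive i j t \<omega> \<longleftrightarrow> j < v) = (if j < v then q * w (t - i) else 1 - q * w (t - i))"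
      by (cases "j < v") (simp_all only: prob_alive[OF assms(1,2)] simp_thms if_True if_False)
  qed
  also have "\<dots> = (q * w (t - i)) ^ v * (1 - q * w (t - i)) ^ (s - v)"
  proof -
    have "{..<s} \<inter> {j. j < v} = {..<v}" "{..<s} \<inter> - {j. j < v} = {v..<s}"
      using assms by auto
    then show ?thesis by (simp add: prod.If_cases)
  qed
  finally have "prob (\<Inter>x\<in>I. E x) = pmf D s * ((q * w (t - i)) ^ v * (1 - q * w (t - i)) ^ (s - v))" .
  moreover have "(\<Inter>x\<in>I. E x) \<subseteq> {\<omega> \<in> space M. N i t \<omega> = v}"
  proof
    fix \<omega> assume \<omega>: "\<omega> \<in> (\<Inter>x\<in>I. E x)"
    have "\<omega> \<in> E None" using INT_D[OF \<omega>, of None] by (simp add: I_def)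
    then have "\<omega> \<in> space M" and s: "B i \<omega> = s" by (simp_all add: E_def)
    have *: "alive i j t \<omega> \<longleftrightarrow> j < v" if "j < s" for j
    proof -
      have "\<omega> \<in> E (Some j)" using INT_D[OF \<omega>, of "Some j"] that by (simp add: I_def)
      then show ?thesis unfolding E_def by simp
    qed
    have "{j. j < B i \<omega> \<and> alive i j t \<omega>} = {..<v}"
      using s * assms by auto
    then show "\<omega> \<in> {\<omega> \<in> space M. N i t \<omega> = v}"
      using \<open>\<omega> \<in> space M\<close> by (simp add: N_def)
  qed
  then have "prob (\<Inter>x\<in>I. E x) \<le> \<P>(\<omega> in M. N i t \<omega> = v)"
    by (intro finite_measure_mono) measurable
  ultimately show ?thesis by simp
qed

text \<open>Contributions are indexed by age \<open>a\<close> instead of batch, so the lower bound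
  does not depend on \<open>t\<close>; this is the source of all uniformity in time.\<close>

lemma prob_recent_ge:
  assumes "A \<le> t" "\<And>a. a < A \<Longrightarrow> v a \<le> s a"
  shows "(\<Prod>a<A. pmf D (s a) * ((q * w a) ^ v a * (1 - q * w a) ^ (s a - v a))) \<le>
    \<P>(\<omega> in M. \<forall>a<A. N (t - a) t \<omega> = v a)"
proof (cases "A = 0")
  \<comment> \<open>Treated apart because the product formula for independent events requires a
    nonempty index set.\<close>
  case True
  then show ?thesis by (simp add: prob_space)
next
  case False
  let ?E = "\<lambda>a. {\<omega> \<in> space M. N (t - a) t \<omega> = v a}"
  have "(\<Prod>a<A. pmf D (s a) * ((q * w a) ^ v a * (1 - q * w a) ^ (s a - v a))) \<le> (\<Prod>a<A. prob (?E a))"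
  proof (intro prod_mono conjI)
    fix a assume "a \<in> {..<A}"
    then show "pmf D (s a) * ((q * w a) ^ v a * (1 - q * w a) ^ (s a - v a)) \<le> prob (?E a)"
      using prob_N_ge[of "t - a" t "v a" "s a"] assms by auto
    show "0 \<le> pmf D (s a) * ((q * w a) ^ v a * (1 - q * w a) ^ (s a - v a))"
      using q_pos q_le_1 w_pos[of a] w_le_1[of a] by (simp add: mult_le_one)
  qed
  also have "\<dots> = prob (\<Inter>a\<in>{..<A}. ?E a)"
  proof (rule indep_setsD[symmetric])
    show "indep_sets (\<lambda>a. sets (source_sigma (batch_sources {t - a}))) {..<A}"
      using assms by (intro indep_sets_source_sigma) (auto simp: disjoint_family_on_def batch_sources_def)
    show "\<forall>a\<in>{..<A}. ?E a \<in> sets (source_sigma (batch_sources {t - a}))"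
    proof
      fix a assume "a \<in> {..<A}"
      then have [measurable]: "N (t - a) t \<in> measurable (source_sigma (batch_sources {t - a})) (count_space UNIV)"
        using assms by (intro N_measurable_batch) auto
      have "{\<omega> \<in> space (source_sigma (batch_sources {t - a})). N (t - a) t \<omega> = v a}
        \<in> sets (source_sigma (batch_sources {t - a}))"
        by measurable
      then show "?E a \<in> sets (source_sigma (batch_sources {t - a}))" by simp
    qed
  qed (use False in auto)
  also have "(\<Inter>a\<in>{..<A}. ?E a) = {\<omega> \<in> space M. \<forall>a<A. N (t - a) t \<omega> = v a}"
    using False by auto
  finally show ?thesis .
qed

text \<open>Both factors of \<open>q * w a\<close> are at most 1, so the product is 1 only if both
  are. For \<open>q < 1\<close> no age is certain, which absorbs the case distinction of the
  definition.\<close>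

lemma least_recurring_size_eq:
  "least_recurring_size \<Delta> f q D = Inf (set_pmf D) * card {a. q * w a = 1}"
proof (cases "q < 1")
  case True
  have "q * w a < 1" for a
    using True w_le_1[of a] w_pos[of a] q_pos by (smt (verit) mult_left_le)
  then have "{a. q * w a = 1} = {}" by (auto simp: less_le)
  then show ?thesis using True by (simp add: least_recurring_size_def)
next
  case False
  then have "q = 1" using q_le_1 by simp
  then show ?thesis by (simp add: least_recurring_size_def)
qed

lemma finite_certain_ages: "finite {a. q * w a = 1}"
proof -
  have "eventually (\<lambda>a. w a < 1) sequentially"
    using order_tendstoD(2)[OF w_tendsto, of 1] by simp
  then obtain A where A: "\<And>a. a \<ge> A \<Longrightarrow> w a < 1"
    by (auto simp: eventually_sequentially)
  have "a < A" if "q * w a = 1" for a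
  proof (rule ccontr)
    assume "\<not> a < A"
    then have "q * w a < 1 * 1"
      using A[of a] q_pos q_le_1 w_pos[of a] by (intro mult_le_less_imp_less) auto
    then show False using that by simp
  qed
  then show ?thesis by (auto simp: finite_nat_set_iff_bounded)
qed

text \<open>Ages whose items are certainly present contribute the least batch size; of the other
  ages, just enough contribute one item each, and the rest none.\<close>

lemma prob_recent_eq_bound:
  assumes "least_recurring_size \<Delta> f q D \<le> m"
  shows "\<exists>A0. \<forall>A\<ge>A0. \<exists>\<delta>>0. \<forall>t\<ge>A. \<delta> \<le> \<P>(\<omega> in M. (\<Sum>i\<in>{t - A<..t}. N i t \<omega>) = m)"
proof -
  define \<beta> where "\<beta> = Inf (set_pmf D)"
  define L where "L = {a. q * w a = 1}"
  obtain s1 where s1: "s1 \<in> set_pmf D" "0 < s1" using size_not_0 by auto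
  have \<beta>: "\<beta> \<in> set_pmf D" unfolding \<beta>_def by (rule Inf_nat_def1) (rule set_pmf_not_empty)
  have m: "\<beta> * card L \<le> m" using assms by (simp add: least_recurring_size_eq \<beta>_def L_def)
  have L: "finite L" unfolding L_def by (rule finite_certain_ages)
  then have "infinite (- L)" by (simp add: finite_compl)
  then obtain Z where Z: "Z \<subseteq> - L" "finite Z" "card Z = m - \<beta> * card L"
    using infinite_arbitrarily_large by metis
  obtain A0 where A0: "L \<union> Z \<subseteq> {..<A0}"
    using finite_nat_iff_bounded[of "L \<union> Z"] L Z by auto
  define v where "v = (\<lambda>a. if a \<in> L then \<beta> else of_bool (a \<in> Z))"
  \<comment> \<open>At an age in \<open>L\<close> the factor \<open>1 - q * w a\<close> is 0, so the
    batch size must equal the number of survivors to make its exponent 0. At the other ages a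
    nonempty size \<open>s1\<close> leaves room for both 0 and 1 survivors.\<close>
  define s where "s = (\<lambda>a. if a \<in> L then \<beta> else s1)"
  have "\<exists>\<delta>>0. \<forall>t\<ge>A. \<delta> \<le> \<P>(\<omega> in M. (\<Sum>i\<in>{t - A<..t}. N i t \<omega>) = m)" if "A0 \<le> A" for A
  proof (intro exI conjI allI impI)
    let ?\<delta> = "\<Prod>a<A. pmf D (s a) * ((q * w a) ^ v a * (1 - q * w a) ^ (s a - v a))"
    show "0 < ?\<delta>"
    proof (intro prod_pos)
      fix a assume "a \<in> {..<A}"
      have "0 < pmf D (s a)" using s1 \<beta> by (simp add: s_def pmf_positive)
      moreover have "0 < (q * w a) ^ v a" using q_pos w_pos[of a] by simp
      moreover have "0 < (1 - q * w a) ^ (s a - v a)"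
      proof (cases "a \<in> L")
        case False
        have "q * w a \<le> 1" using q_pos q_le_1 w_pos[of a] w_le_1[of a] by (simp add: mult_le_one)
        then have "q * w a < 1" using False by (simp add: L_def)
        then show ?thesis by simp
      qed (simp add: s_def v_def)
      ultimately show "0 < pmf D (s a) * ((q * w a) ^ v a * (1 - q * w a) ^ (s a - v a))" by simp
    qed
    fix t assume t: "A \<le> t"
    have [measurable]: "i \<in> {t - A<..t} \<Longrightarrow> N i t \<in> measurable M (count_space UNIV)" for i
      by (intro N_rv) auto
    have sub: "L \<union> Z \<subseteq> {..<A}" using A0 that by auto
    have "(\<Sum>a<A. v a) = (\<Sum>a\<in>L \<union> Z. v a)"
      using sub by (intro sum.mono_neutral_right) (auto simp: v_def)
    also have "\<dots> = (\<Sum>a\<in>L. v a) + (\<Sum>a\<in>Z. v a)"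
      using Z L by (intro sum.union_disjoint) auto
    also have "(\<Sum>a\<in>L. v a) = (\<Sum>a\<in>L. \<beta>)"
      by (intro sum.cong) (auto simp: v_def)
    also have "(\<Sum>a\<in>Z. v a) = (\<Sum>a\<in>Z. 1)"
      using Z by (intro sum.cong) (auto simp: v_def)
    finally have "(\<Sum>a<A. v a) = m" using Z m by (simp add: mult.commute)
    then have "(\<Sum>i\<in>{t - A<..t}. N i t \<omega>) = m" if "\<forall>a<A. N (t - a) t \<omega> = v a" for \<omega>
      using that by (subst sum_recent[OF t]) simp
    then have "{\<omega> \<in> space M. \<forall>a<A. N (t - a) t \<omega> = v a} \<subseteq> {\<omega> \<in> space M. (\<Sum>i\<in>{t - A<..t}. N i t \<omega>) = m}"
      by blast
    then have "\<P>(\<omega> in M. \<forall>a<A. N (t - a) t \<omega> = v a) \<le> \<P>(\<omega> in M. (\<Sum>i\<in>{t - A<..t}. N i t \<omega>) = m)"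
      by (intro finite_measure_mono) measurable
    moreover have "?\<delta> \<le> \<P>(\<omega> in M. \<forall>a<A. N (t - a) t \<omega> = v a)"
      using s1(2) by (intro prob_recent_ge[OF t]) (simp add: v_def s_def)
    ultimately show "?\<delta> \<le> \<P>(\<omega> in M. (\<Sum>i\<in>{t - A<..t}. N i t \<omega>) = m)" by simp
  qed
  then show ?thesis by blast
qed

section \<open>The sample size as a sum over batches\<close>

abbreviation C :: "nat \<Rightarrow> 'w \<Rightarrow> nat" where
  "C \<equiv> sample_size B ins ret"

lemma C_measurable_past: "t \<le> s \<Longrightarrow> C t \<in> measurable (source_sigma (past_sources s)) (count_space UNIV)"
proof -
  assume "t \<le> s"
  then have [measurable]: "i \<in> {1..t} \<Longrightarrow> N i t \<in> measurable (source_sigma (past_sources s)) (count_space UNIV)" for i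
    by (intro N_measurable_past) auto
  show ?thesis unfolding sample_size_eq[abs_def] by measurable
qed

lemma C_rv [measurable]: "random_variable (count_space UNIV) (C t)"
  by (rule measurable_source_sigma_M[OF past_sources_subset C_measurable_past[OF order_refl]])

text \<open>Take \<open>k = m\<close>: with positive probability each of the first \<open>m\<close>
  batches has the positive size \<open>s1\<close> and loses no item.\<close>

lemma prob_C_ge_pos: "\<exists>k. 0 < \<P>(\<omega> in M. m \<le> C k \<omega>)"
proof
  obtain s1 where s1: "s1 \<in> set_pmf D" "0 < s1" using size_not_0 by auto
  have "0 < (\<Prod>a<m. pmf D s1 * ((q * w a) ^ s1 * (1 - q * w a) ^ (s1 - s1)))"
    using s1 q_pos w_pos by (intro prod_pos) (simp add: pmf_positive)
  also have "\<dots> \<le> \<P>(\<omega> in M. \<forall>a<m. N (m - a) m \<omega> = s1)"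
    by (intro prob_recent_ge) auto
  also have "\<dots> \<le> \<P>(\<omega> in M. m \<le> C m \<omega>)"
  proof (intro finite_measure_mono subsetI)
    fix \<omega> assume *: "\<omega> \<in> {\<omega> \<in> space M. \<forall>a<m. N (m - a) m \<omega> = s1}"
    have "{1..m} = {m - m<..m}" by auto
    then have "C m \<omega> = (\<Sum>a<m. N (m - a) m \<omega>)"
      using sum_recent[of m m "\<lambda>i. N i m \<omega>"] by (simp add: sample_size_eq)
    also have "\<dots> = m * s1" using * by simp
    finally show "\<omega> \<in> {\<omega> \<in> space M. m \<le> C m \<omega>}" using * s1 by simp
  qed measurable
  finally show "0 < \<P>(\<omega> in M. m \<le> C m \<omega>)" .
qed

text \<open>Form relative to a past event \<open>E\<close>: on at least half of \<open>E\<close> the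
  batches up to \<open>k\<close> are extinct at \<open>t\<close>, and independently the later
  batches supply exactly \<open>m\<close> items.\<close>

lemma prob_Int_C_eq_ge:
  assumes "E \<in> sets (source_sigma (past_sources k))"
    and "\<delta> \<le> \<P>(\<omega> in M. (\<Sum>i\<in>{k<..t}. N i t \<omega>) = m)" "0 \<le> \<delta>" "k \<le> t"
    and old: "(\<integral>\<^sup>+\<omega>. (\<Sum>i\<in>{1..k}. of_nat (N i t \<omega>)) * indicator E \<omega> \<partial>M) \<le> ennreal (prob E / 2)"
  shows "\<delta> / 2 * prob E \<le> prob (E \<inter> {\<omega> \<in> space M. C t \<omega> = m})"
proof -
  let ?O = "{\<omega> \<in> space M. (\<Sum>i\<in>{1..k}. N i t \<omega>) = 0}" and ?R = "{\<omega> \<in> space M. (\<Sum>i\<in>{k<..t}. N i t \<omega>) = m}"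
  let ?J = "batch_sources {..k}" and ?K = "batch_sources {k<..t}"
  \<comment> \<open>Extinction at \<open>t\<close> of the old batches uses coins tossed after
    \<open>k\<close>. Hence \<open>E\<close> is regarded as depending on all sources of the batches
    up to \<open>k\<close>, which are still disjoint from those of the later batches.\<close>
  have EJ: "E \<in> sets (source_sigma ?J)"
    using source_sigma_mono[OF past_sources_subset_batch] assms by auto
  have [measurable]: "i \<in> {1..k} \<Longrightarrow> N i t \<in> measurable (source_sigma ?J) (count_space UNIV)"
    "i \<in> {k<..t} \<Longrightarrow> N i t \<in> measurable (source_sigma ?K) (count_space UNIV)"
    "i \<in> {k<..t} \<Longrightarrow> N i t \<in> measurable M (count_space UNIV)"
    "i \<in> {1..k} \<Longrightarrow> N i t \<in> measurable M (count_space UNIV)" for i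
    using assms by (auto intro!: N_measurable_batch N_rv)
  have "{\<omega> \<in> space (source_sigma ?J). (\<Sum>i\<in>{1..k}. N i t \<omega>) = 0} \<in> sets (source_sigma ?J)" by measurable
  then have "E \<inter> ?O \<in> sets (source_sigma ?J)" by (intro sets.Int[OF EJ]) (simp only: space_source_sigma)
  moreover have "{\<omega> \<in> space (source_sigma ?K). (\<Sum>i\<in>{k<..t}. N i t \<omega>) = m} \<in> sets (source_sigma ?K)" by measurable
  then have "?R \<in> sets (source_sigma ?K)" by (simp only: space_source_sigma)
  moreover have "?J \<inter> ?K = {}" by (auto simp: batch_sources_def)
  ultimately have prod: "prob (E \<inter> ?O \<inter> ?R) = prob (E \<inter> ?O) * prob ?R"
    by (intro prob_Int_source_sigma[OF batch_sources_subset batch_sources_subset])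
  have [measurable]: "E \<in> events"
    using EJ source_sigma_events[OF batch_sources_subset] by auto
  have le: "prob (E \<inter> ?O \<inter> ?R) \<le> prob (E \<inter> {\<omega> \<in> space M. C t \<omega> = m})"
  proof (intro finite_measure_mono subsetI)
    fix \<omega>
    have "{1..t} = {1..k} \<union> {k<..t}" using assms by auto
    then have "C t \<omega> = (\<Sum>i\<in>{1..k}. N i t \<omega>) + (\<Sum>i\<in>{k<..t}. N i t \<omega>)"
      unfolding sample_size_eq by (simp only:) (intro sum.union_disjoint; auto)
    moreover assume "\<omega> \<in> E \<inter> ?O \<inter> ?R"
    ultimately show "\<omega> \<in> E \<inter> {\<omega> \<in> space M. C t \<omega> = m}" by simp
  qed measurable
  have "prob E / 2 \<le> prob (E \<inter> ?O)"
    using prob_Int_eq_0_ge[OF _ \<open>E \<in> events\<close>, of "\<lambda>\<omega>. \<Sum>i\<in>{1..k}. N i t \<omega>" "prob E / 2"] old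
    by (simp only: of_nat_sum) simp
  then have "prob E / 2 * \<delta> \<le> prob (E \<inter> ?O) * prob ?R"
    using assms(2,3) by (intro mult_mono measure_nonneg)
  then show ?thesis using prod le by (simp add: mult_ac)
qed

section \<open>Infinitely many visits\<close>

text \<open>The limit of the mean sample size.\<close>

definition target :: real where "target = q * mean_size * (\<Sum>a. w a)"

lemma sum_w_past: "k \<le> t \<Longrightarrow> (\<Sum>i\<in>{1..k}. w (t - i)) = (\<Sum>a<t. w a) - (\<Sum>a<t - k. w a)"
proof -
  assume "k \<le> t"
  then have "(\<Sum>i\<in>{1..k}. w (t - i)) = (\<Sum>a\<in>{t - k..<t}. w a)"
    by (intro sum.reindex_bij_witness[of _ "\<lambda>a. t - a" "\<lambda>i. t - i"]) auto
  also have "\<dots> = (\<Sum>a<t. w a) - (\<Sum>a<t - k. w a)"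
    using sum_diff_nat_ivl[of 0 "t - k" t w] by (simp add: atLeast0LessThan)
  finally show ?thesis .
qed

lemma sum_w_le: "(\<Sum>a<t. w a) \<le> (\<Sum>a. w a)"
  using w_pos by (intro sum_le_suminf[OF w_summable]) (auto intro: less_imp_le)

lemma nn_integral_sum_N:
  assumes "k \<le> t"
  shows "(\<integral>\<^sup>+\<omega>. (\<Sum>i\<in>{1..k}. of_nat (N i t \<omega>)) \<partial>M) =
    ennreal (q * mean_size * ((\<Sum>a<t. w a) - (\<Sum>a<t - k. w a)))"
proof -
  have [measurable]: "i \<in> {1..k} \<Longrightarrow> N i t \<in> measurable M (count_space UNIV)" for i
    using assms by (intro N_rv) auto
  have "(\<integral>\<^sup>+\<omega>. (\<Sum>i\<in>{1..k}. of_nat (N i t \<omega>)) \<partial>M) = (\<Sum>i\<in>{1..k}. ennreal (q * mean_size * w (t - i)))"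
    using assms by (subst nn_integral_sum) (auto simp: nn_integral_N)
  also have "\<dots> = ennreal (\<Sum>i\<in>{1..k}. q * mean_size * w (t - i))"
    using q_pos mean_size_nonneg w_pos by (intro sum_ennreal) (simp add: less_imp_le)
  finally show ?thesis
    unfolding sum_distrib_left[symmetric] sum_w_past[OF assms] .
qed

lemma prob_C_eq_bound:
  assumes "least_recurring_size \<Delta> f q D \<le> m"
  shows "\<exists>\<delta>>0. \<exists>K. \<forall>k\<ge>K. \<delta> \<le> \<P>(\<omega> in M. C k \<omega> = m)"
proof -
  obtain A0 where A0: "\<And>A. A0 \<le> A \<Longrightarrow> \<exists>\<delta>>0. \<forall>t\<ge>A. \<delta> \<le> \<P>(\<omega> in M. (\<Sum>i\<in>{t - A<..t}. N i t \<omega>) = m)"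
    using prob_recent_eq_bound[OF assms] by blast
  \<comment> \<open>\<open>A\<close> is chosen such that the tail of the series beyond
    \<open>A\<close>, which bounds the mean number of items of age at least \<open>A\<close> at any
    time, is below 1/2.\<close>
  have "(\<lambda>A. q * mean_size * ((\<Sum>a. w a) - (\<Sum>a<A. w a))) \<longlonglongrightarrow> q * mean_size * ((\<Sum>a. w a) - (\<Sum>a. w a))"
    by (intro tendsto_intros summable_LIMSEQ w_summable)
  then have "eventually (\<lambda>A. q * mean_size * ((\<Sum>a. w a) - (\<Sum>a<A. w a)) < 1 / 2) sequentially"
    by (intro order_tendstoD(2)) auto
  then have "eventually (\<lambda>A. A0 \<le> A \<and> q * mean_size * ((\<Sum>a. w a) - (\<Sum>a<A. w a)) < 1 / 2) sequentially"
    by (intro eventually_conj eventually_ge_at_top)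
  then obtain A where A: "A0 \<le> A" "q * mean_size * ((\<Sum>a. w a) - (\<Sum>a<A. w a)) < 1 / 2"
    unfolding eventually_sequentially by blast
  obtain \<delta> where \<delta>: "0 < \<delta>" "\<And>t. A \<le> t \<Longrightarrow> \<delta> \<le> \<P>(\<omega> in M. (\<Sum>i\<in>{t - A<..t}. N i t \<omega>) = m)"
    using A0[OF A(1)] by blast
  have "\<delta> / 2 \<le> \<P>(\<omega> in M. C t \<omega> = m)" if t: "A \<le> t" for t
  proof -
    have "q * mean_size * ((\<Sum>a<t. w a) - (\<Sum>a<t - (t - A). w a)) \<le> q * mean_size * ((\<Sum>a. w a) - (\<Sum>a<A. w a))"
      using q_pos mean_size_nonneg sum_w_le[of t] t by (intro mult_left_mono) auto
    then have "(\<integral>\<^sup>+\<omega>. (\<Sum>i\<in>{1..t - A}. of_nat (N i t \<omega>)) \<partial>M) \<le> ennreal (1 / 2)"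
      using A(2) by (subst nn_integral_sum_N) (simp, intro ennreal_leI, linarith)
    then have "(\<integral>\<^sup>+\<omega>. (\<Sum>i\<in>{1..t - A}. of_nat (N i t \<omega>)) * indicator (space M) \<omega> \<partial>M) \<le> ennreal (prob (space M) / 2)"
      by (simp add: prob_space cong: nn_integral_cong_simp)
    moreover have "space M \<in> sets (source_sigma (past_sources (t - A)))"
      using sets.top[of "source_sigma (past_sources (t - A))"] by simp
    ultimately have "\<delta> / 2 * prob (space M) \<le> prob (space M \<inter> {\<omega> \<in> space M. C t \<omega> = m})"
      using \<delta> t by (intro prob_Int_C_eq_ge[where k = "t - A"]) auto
    moreover have "space M \<inter> {\<omega> \<in> space M. C t \<omega> = m} = {\<omega> \<in> space M. C t \<omega> = m}" by auto
    ultimately show ?thesis by (simp add: prob_space)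
  qed
  then show ?thesis using \<delta>(1) by (intro exI[of _ "\<delta> / 2"]) auto
qed

lemma N_antimono: "t \<le> t' \<Longrightarrow> N i t' \<omega> \<le> N i t \<omega>"
  unfolding N_def alive_def by (intro card_mono) auto

text \<open>The mean number of survivors of age \<open>a\<close> tends to 0, hence the probability
  of extinction by age \<open>a\<close> tends to 1; extinction is permanent by
  \<open>N_antimono\<close>.\<close>

lemma AE_batch_extinct:
  assumes "1 \<le> i"
  shows "AE \<omega> in M. eventually (\<lambda>t. N i t \<omega> = 0) sequentially"
proof -
  let ?Z = "{\<omega> \<in> space M. \<exists>a. N i (i + a) \<omega> = 0}"
  have [measurable]: "random_variable (count_space UNIV) (N i (i + a))" for a
    using assms by (intro N_rv) auto
  have Z: "?Z \<in> events" by measurable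
  have "1 - q * mean_size * w a \<le> prob ?Z" for a
  proof -
    have "(\<integral>\<^sup>+\<omega>. of_nat (N i (i + a) \<omega>) * indicator (space M) \<omega> \<partial>M) \<le> ennreal (q * mean_size * w a)"
      using nn_integral_N[of i "i + a"] assms by (simp cong: nn_integral_cong_simp)
    then have "prob (space M) - q * mean_size * w a \<le> prob (space M \<inter> {\<omega> \<in> space M. N i (i + a) \<omega> = 0})"
      using q_pos mean_size_nonneg w_pos[of a] by (intro prob_Int_eq_0_ge) auto
    also have "\<dots> \<le> prob ?Z"
      by (intro finite_measure_mono[OF _ Z]) auto
    finally show ?thesis by (simp add: prob_space)
  qed
  moreover have "(\<lambda>a. 1 - q * mean_size * w a) \<longlonglongrightarrow> 1 - q * mean_size * 0"
    by (intro tendsto_intros w_tendsto)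
  ultimately have "1 \<le> prob ?Z"
    by (intro LIMSEQ_le_const2[where x = 1]) auto
  then have "prob ?Z = 1" using prob_le_1[of ?Z] by linarith
  then have "AE \<omega> in M. \<omega> \<in> ?Z" using Z by (simp add: prob_eq_1)
  then show ?thesis
  proof eventually_elim
    case (elim \<omega>)
    then obtain a where "N i (i + a) \<omega> = 0" by auto
    then have "N i t \<omega> = 0" if "i + a \<le> t" for t
      using N_antimono[OF that, of i \<omega>] by simp
    then show ?case by (auto simp: eventually_sequentially)
  qed
qed

lemma sum_late_measurable:
  "n \<le> s \<Longrightarrow> (\<lambda>\<omega>. \<Sum>i\<in>{s<..t}. N i t \<omega>) \<in> measurable (source_sigma (batch_sources {n<..})) (count_space UNIV)"
proof -
  assume "n \<le> s"
  then have [measurable]: "i \<in> {s<..t} \<Longrightarrow> N i t \<in> measurable (source_sigma (batch_sources {n<..})) (count_space UNIV)" for i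
    by (intro N_measurable_batch) auto
  show ?thesis by measurable
qed

text \<open>Each batch dies out, so up to a null set the event of infinitely many visits does not
  depend on any finite number of batches.\<close>

lemma prob_infinitely_often_0_1:
  "\<P>(\<omega> in M. \<exists>\<^sub>\<infinity>k. C k \<omega> = m) \<in> {0, 1}"
proof -
  \<comment> \<open>\<open>L s\<close> is the event of infinitely many visits with the first
    \<open>s\<close> batches deleted. Asking for it at arbitrarily large \<open>s\<close> makes
    \<open>V\<close> a tail event by construction.\<close>
  define L where "L s \<omega> \<longleftrightarrow> (\<forall>k. \<exists>t\<ge>k. (\<Sum>i\<in>{s<..t}. N i t \<omega>) = m)" for s \<omega>
  define V where "V = {\<omega> \<in> space M. \<forall>k. \<exists>s\<ge>k. L s \<omega>}"
  \<comment> \<open>Batches are numbered from 1, so the sigma-algebra with index \<open>n\<close>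
    belongs to batch \<open>Suc n\<close>, and those from \<open>n\<close> on to
    \<open>{n<..}\<close>.\<close>
  let ?A = "\<lambda>n. sets (source_sigma (batch_sources {Suc n}))"
  have V: "V \<in> sets (source_sigma (batch_sources {n<..}))" for n
  proof -
    define P where "P s \<omega> \<longleftrightarrow> n \<le> s \<and> L s \<omega>" for s \<omega>
    have [measurable]: "Measurable.pred (source_sigma (batch_sources {n<..})) (P s)" for s
    proof (cases "n \<le> s")
      case True
      note [measurable] = sum_late_measurable[OF True]
      show ?thesis unfolding P_def L_def by measurable
    next
      case False
      then have "P s = (\<lambda>_. False)" by (simp add: P_def fun_eq_iff)
      then show ?thesis by simp
    qed
    have "(\<forall>k. \<exists>s\<ge>k. L s \<omega>) \<longleftrightarrow> (\<forall>k. \<exists>s\<ge>k. P s \<omega>)" for \<omega>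
      unfolding P_def by (meson max.bounded_iff)
    then have "V = {\<omega> \<in> space (source_sigma (batch_sources {n<..})). \<forall>k. \<exists>s\<ge>k. P s \<omega>}"
      unfolding V_def by simp
    also have "\<dots> \<in> sets (source_sigma (batch_sources {n<..}))" by measurable
    finally show ?thesis .
  qed
  have "V \<in> tail_events ?A"
    unfolding tail_events_def
  proof
    fix n
    have "sets (source_sigma (batch_sources {n<..})) \<subseteq> sigma_sets (space M) (\<Union> (?A ` {n..}))"
      unfolding sets_source_sigma[of "batch_sources {n<..}"]
    proof (intro sigma_sets_mono subsetI, elim CollectE exE conjE)
      fix x s A assume x: "x = source_value B ins ret s -` A \<inter> space M" and s: "s \<in> batch_sources {n<..}"
      then obtain k where k: "batch_of s = Suc k" "n \<le> k"
        unfolding batch_sources_def by (cases "batch_of s") auto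
      then have "s \<in> batch_sources {Suc k}" using s by (simp add: batch_sources_def)
      then have "x \<in> ?A k" unfolding sets_source_sigma x by (intro sigma_sets.Basic) blast
      then show "x \<in> sigma_sets (space M) (\<Union> (?A ` {n..}))" using k by (intro sigma_sets.Basic) auto
    qed
    then show "V \<in> sigma_sets (space M) (\<Union> (?A ` {n..}))" using V by blast
  qed
  moreover have "indep_sets ?A UNIV"
    by (rule indep_sets_source_sigma) (auto simp: disjoint_family_on_def batch_sources_def)
  moreover have "sigma_algebra (space M) (?A n)" for n
    using sets.sigma_algebra_axioms[of "source_sigma (batch_sources {Suc n})"] by simp
  ultimately have "prob V = 0 \<or> prob V = 1"
    by (intro kolmogorov_0_1_law[of ?A])
  moreover have "prob V = \<P>(\<omega> in M. \<exists>\<^sub>\<infinity>k. C k \<omega> = m)"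
  proof (rule finite_measure_eq_AE)
    have "AE \<omega> in M. \<forall>i\<ge>1. eventually (\<lambda>t. N i t \<omega> = 0) sequentially"
      using AE_batch_extinct by (simp add: AE_all_countable)
    then show "AE \<omega> in M. \<omega> \<in> V \<longleftrightarrow> \<omega> \<in> {\<omega> \<in> space M. \<exists>\<^sub>\<infinity>k. C k \<omega> = m}"
    proof (eventually_elim)
      case (elim \<omega>)
      \<comment> \<open>Once the first \<open>s\<close> batches are extinct, deleting them no longer
        changes the count, so every \<open>L s\<close> agrees with the original event.\<close>
      have "L s \<omega> \<longleftrightarrow> (\<exists>\<^sub>\<infinity>k. C k \<omega> = m)" for s
      proof -
        have "eventually (\<lambda>t. \<forall>i\<in>{1..s}. N i t \<omega> = 0) sequentially"
          using elim by (intro eventually_ball_finite) auto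
        then have "eventually (\<lambda>t. s \<le> t \<and> (\<forall>i\<in>{1..s}. N i t \<omega> = 0)) sequentially"
          by (intro eventually_conj eventually_ge_at_top)
        then have "eventually (\<lambda>t. (\<Sum>i\<in>{s<..t}. N i t \<omega>) = C t \<omega>) sequentially"
        proof eventually_elim
          case (elim t)
          then show ?case unfolding sample_size_eq by (intro sum.mono_neutral_left) auto
        qed
        then have "eventually (\<lambda>t. (\<Sum>i\<in>{s<..t}. N i t \<omega>) = m \<longleftrightarrow> C t \<omega> = m) sequentially"
          by eventually_elim simp
        then have "(\<exists>\<^sub>\<infinity>t. (\<Sum>i\<in>{s<..t}. N i t \<omega>) = m) \<longleftrightarrow> (\<exists>\<^sub>\<infinity>t. C t \<omega> = m)"
          unfolding cofinite_eq_sequentially by (rule frequently_cong) simp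
        then show ?thesis by (simp add: L_def INFM_nat_le)
      qed
      then show ?case by (auto simp: V_def)
    qed
    show "V \<in> events" using V source_sigma_events[OF batch_sources_subset] by blast
    show "{\<omega> \<in> space M. \<exists>\<^sub>\<infinity>k. C k \<omega> = m} \<in> events"
      unfolding INFM_nat_le by measurable
  qed
  ultimately show ?thesis by auto
qed

text \<open>The events of a visit after \<open>n\<close> decrease with \<open>n\<close> and have
  probability at least \<open>\<delta>\<close> eventually; so has their intersection, and the 0-1
  law raises this to 1.\<close>

lemma prob_infinitely_often:
  assumes "least_recurring_size \<Delta> f q D \<le> m"
  shows "\<P>(\<omega> in M. \<exists>\<^sub>\<infinity>k. C k \<omega> = m) = 1"
proof -
  obtain \<delta> K where \<delta>: "0 < \<delta>" "\<And>k. K \<le> k \<Longrightarrow> \<delta> \<le> \<P>(\<omega> in M. C k \<omega> = m)"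
    using prob_C_eq_bound[OF assms] by blast
  let ?U = "\<lambda>n. {\<omega> \<in> space M. \<exists>k\<ge>n. C k \<omega> = m}"
  have "(\<lambda>n. prob (?U n)) \<longlonglongrightarrow> prob (\<Inter>n. ?U n)"
    by (intro finite_Lim_measure_decseq) (auto simp: decseq_def intro: order_trans)
  moreover have "\<delta> \<le> prob (?U n)" if "K \<le> n" for n
  proof -
    have "\<P>(\<omega> in M. C n \<omega> = m) \<le> prob (?U n)"
      by (intro finite_measure_mono) auto
    then show ?thesis using \<delta>(2)[OF that] by simp
  qed
  ultimately have "\<delta> \<le> prob (\<Inter>n. ?U n)"
    by (intro LIMSEQ_le_const[where x = "prob (\<Inter>n. ?U n)"]) auto
  also have "(\<Inter>n. ?U n) = {\<omega> \<in> space M. \<exists>\<^sub>\<infinity>k. C k \<omega> = m}"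
    by (auto simp: INFM_nat_le)
  finally show ?thesis
    using prob_infinitely_often_0_1[of m] \<delta>(1) by auto
qed

section \<open>Drift of the sample size\<close>

lemma C_split: "C (k + A) \<omega> = (\<Sum>i\<in>{1..k}. N i (k + A) \<omega>) + (\<Sum>i\<in>{k<..k + A}. N i (k + A) \<omega>)"
proof -
  have "{1..k + A} = {1..k} \<union> {k<..k + A}" by auto
  then show ?thesis
    unfolding sample_size_eq by (simp only:) (intro sum.union_disjoint; auto)
qed

lemma nn_integral_C_le: "(\<integral>\<^sup>+\<omega>. of_nat (C t \<omega>) \<partial>M) \<le> ennreal target"
proof -
  have "(\<integral>\<^sup>+\<omega>. of_nat (C t \<omega>) \<partial>M) = ennreal (q * mean_size * (\<Sum>a<t. w a))"
    using nn_integral_sum_N[of t t] by (simp add: sample_size_eq)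
  also have "\<dots> \<le> ennreal target"
    unfolding target_def using q_pos mean_size_nonneg sum_w_le
    by (intro ennreal_leI mult_left_mono) auto
  finally show ?thesis .
qed

lemma target_nonneg: "0 \<le> target"
  unfolding target_def using q_pos mean_size_nonneg w_pos
  by (intro mult_nonneg_nonneg suminf_nonneg w_summable) (auto intro: less_imp_le)

lemma nn_integral_sum_N_indicator:
  assumes "E \<in> events" "I \<subseteq> {1..t}"
  shows "(\<integral>\<^sup>+\<omega>. (\<Sum>i\<in>I. of_nat (N i t \<omega>)) * indicator E \<omega> \<partial>M) =
      (\<Sum>i\<in>I. \<integral>\<^sup>+\<omega>. of_nat (N i t \<omega>) * indicator E \<omega> \<partial>M)"
proof -
  note [measurable] = assms(1)
  have [measurable]: "random_variable (count_space UNIV) (N i t)" if "i \<in> I" for i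
    using that assms(2) by (auto intro!: N_rv)
  show ?thesis
    unfolding sum_distrib_right by (rule nn_integral_sum) measurable
qed

text \<open>The contraction factor \<open>\<epsilon>\<close> is the same for all ages, so the items
  present at \<open>k\<close> may be counted without regard to their ages.\<close>

lemma nn_integral_old_le:
  assumes E: "E \<in> sets (source_sigma (past_sources k))" and contr: "\<And>i. w (i + A) \<le> \<epsilon> * w i"
  shows "(\<integral>\<^sup>+\<omega>. (\<Sum>i\<in>{1..k}. of_nat (N i (k + A) \<omega>)) * indicator E \<omega> \<partial>M) \<le>
    ennreal \<epsilon> * (\<integral>\<^sup>+\<omega>. of_nat (C k \<omega>) * indicator E \<omega> \<partial>M)"
proof -
  have [measurable]: "E \<in> events" using E source_sigma_events[OF past_sources_subset] by blast
  have "(\<integral>\<^sup>+\<omega>. (\<Sum>i\<in>{1..k}. of_nat (N i (k + A) \<omega>)) * indicator E \<omega> \<partial>M) =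
      (\<Sum>i\<in>{1..k}. \<integral>\<^sup>+\<omega>. of_nat (N i (k + A) \<omega>) * indicator E \<omega> \<partial>M)"
    by (rule nn_integral_sum_N_indicator) auto
  also have "\<dots> \<le> (\<Sum>i\<in>{1..k}. ennreal \<epsilon> * (\<integral>\<^sup>+\<omega>. of_nat (N i k \<omega>) * indicator E \<omega> \<partial>M))"
  proof (intro sum_mono)
    fix i assume "i \<in> {1..k}"
    then have i: "1 \<le> i" "i \<le> k" by auto
    have "w (k + A - i) \<le> \<epsilon> * w (k - i)"
      using contr[of "k - i"] i by simp
    then have "w (k + A - i) / w (k - i) \<le> \<epsilon>"
      using w_pos[of "k - i"] by (subst pos_divide_le_eq) auto
    then show "(\<integral>\<^sup>+\<omega>. of_nat (N i (k + A) \<omega>) * indicator E \<omega> \<partial>M) \<le>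
        ennreal \<epsilon> * (\<integral>\<^sup>+\<omega>. of_nat (N i k \<omega>) * indicator E \<omega> \<partial>M)"
      by (subst nn_integral_N_survive[OF E i]) (auto intro!: mult_right_mono ennreal_leI)
  qed
  also have "\<dots> = ennreal \<epsilon> * (\<integral>\<^sup>+\<omega>. (\<Sum>i\<in>{1..k}. of_nat (N i k \<omega>)) * indicator E \<omega> \<partial>M)"
    unfolding sum_distrib_left[symmetric] by (subst nn_integral_sum_N_indicator) auto
  finally show ?thesis by (simp add: sample_size_eq)
qed

lemma nn_integral_new_le:
  assumes E: "E \<in> sets (source_sigma (past_sources k))"
  shows "(\<integral>\<^sup>+\<omega>. (\<Sum>i\<in>{k<..k + A}. of_nat (N i (k + A) \<omega>)) * indicator E \<omega> \<partial>M) \<le> ennreal (target * prob E)"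
proof -
  have [measurable]: "E \<in> events" using E source_sigma_events[OF past_sources_subset] by blast
  have "(\<integral>\<^sup>+\<omega>. (\<Sum>i\<in>{k<..k + A}. of_nat (N i (k + A) \<omega>)) * indicator E \<omega> \<partial>M) =
      (\<Sum>i\<in>{k<..k + A}. \<integral>\<^sup>+\<omega>. of_nat (N i (k + A) \<omega>) * indicator E \<omega> \<partial>M)"
    by (rule nn_integral_sum_N_indicator) auto
  also have "\<dots> = (\<Sum>i\<in>{k<..k + A}. ennreal (prob E * (q * mean_size * w (k + A - i))))"
  proof (intro sum.cong refl nn_integral_N_later[OF past_sources_subset _ E])
    fix i assume "i \<in> {k<..k + A}"
    then show "past_sources k \<inter> batch_sources {i} = {}"
      using past_sources_subset_batch[of k] by (auto simp: batch_sources_def)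
  qed auto
  also have "\<dots> = ennreal (\<Sum>i\<in>{k<..k + A}. prob E * (q * mean_size * w (k + A - i)))"
    by (intro sum_ennreal mult_nonneg_nonneg measure_nonneg mean_size_nonneg less_imp_le[OF q_pos] less_imp_le[OF w_pos])
  also have "(\<Sum>i\<in>{k<..k + A}. prob E * (q * mean_size * w (k + A - i))) = prob E * (q * mean_size * (\<Sum>a<A. w a))"
  proof -
    have "(\<Sum>i\<in>{k<..k + A}. w (k + A - i)) = (\<Sum>a<A. w a)"
      by (rule sum.reindex_bij_witness[of _ "\<lambda>a. k + A - a" "\<lambda>i. k + A - i"]) auto
    then show ?thesis unfolding sum_distrib_left[symmetric] by (simp only:)
  qed
  also have "\<dots> \<le> target * prob E"
    unfolding target_def using q_pos mean_size_nonneg sum_w_le[of A]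
    by (subst mult.commute) (intro mult_right_mono mult_left_mono; simp)
  finally show ?thesis by (simp add: ennreal_leI)
qed

text \<open>The Foster-Lyapunov inequality, with integration over past events in place of a
  conditional expectation: survivors shrink by \<open>\<epsilon>\<close>, arrivals add at most
  \<open>target\<close> in mean.\<close>

lemma drift:
  assumes E: "E \<in> sets (source_sigma (past_sources k))" and contr: "\<And>i. w (i + A) \<le> \<epsilon> * w i"
  shows "(\<integral>\<^sup>+\<omega>. of_nat (C (k + A) \<omega>) * indicator E \<omega> \<partial>M) \<le>
    ennreal \<epsilon> * (\<integral>\<^sup>+\<omega>. of_nat (C k \<omega>) * indicator E \<omega> \<partial>M) + ennreal (target * prob E)"
proof -
  have [measurable]: "E \<in> events" using E source_sigma_events[OF past_sources_subset] by blast
  have [measurable]: "random_variable (count_space UNIV) (N i (k + A))" if "i \<in> {1..k + A}" for i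
    using that by (auto intro!: N_rv)
  have "(\<integral>\<^sup>+\<omega>. of_nat (C (k + A) \<omega>) * indicator E \<omega> \<partial>M) =
      (\<integral>\<^sup>+\<omega>. (\<Sum>i\<in>{1..k}. of_nat (N i (k + A) \<omega>)) * indicator E \<omega> \<partial>M) +
      (\<integral>\<^sup>+\<omega>. (\<Sum>i\<in>{k<..k + A}. of_nat (N i (k + A) \<omega>)) * indicator E \<omega> \<partial>M)"
    unfolding C_split of_nat_add of_nat_sum distrib_right
  proof (rule nn_integral_add)
    show "(\<lambda>\<omega>. (\<Sum>i\<in>{1..k}. of_nat (N i (k + A) \<omega>)) * indicator E \<omega> :: ennreal) \<in> borel_measurable M"
      by (intro borel_measurable_times_ennreal borel_measurable_sum) measurable
    show "(\<lambda>\<omega>. (\<Sum>i\<in>{k<..k + A}. of_nat (N i (k + A) \<omega>)) * indicator E \<omega> :: ennreal) \<in> borel_measurable M"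
      by (intro borel_measurable_times_ennreal borel_measurable_sum) measurable
  qed
  then show ?thesis
    using nn_integral_old_le[OF E contr] nn_integral_new_le[OF E, of A] by (simp add: add_mono)
qed

text \<open>From a sample of size at most \<open>c\<close>, the mean number of survivors after
  \<open>A\<close> steps is at most \<open>\<epsilon> * c\<close>, hence at most 1/2, as
  \<open>prob_Int_C_eq_ge\<close> requires.\<close>

lemma prob_hit_ge:
  assumes E: "E \<in> sets (source_sigma (past_sources k))" and contr: "\<And>i. w (i + A) \<le> \<epsilon> * w i"
    and small: "\<And>\<omega>. \<omega> \<in> E \<Longrightarrow> real (C k \<omega>) \<le> c" and c: "\<epsilon> * c \<le> 1 / 2" "0 \<le> \<epsilon>" "0 \<le> c"
    and \<delta>: "\<delta> \<le> \<P>(\<omega> in M. (\<Sum>i\<in>{k<..k + A}. N i (k + A) \<omega>) = m)" "0 \<le> \<delta>"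
  shows "\<delta> / 2 * prob E \<le> prob (E \<inter> {\<omega> \<in> space M. C (k + A) \<omega> = m})"
proof (rule prob_Int_C_eq_ge[OF E \<delta>])
  have [measurable]: "E \<in> events" using E source_sigma_events[OF past_sources_subset] by blast
  have "(\<integral>\<^sup>+\<omega>. of_nat (C k \<omega>) * indicator E \<omega> \<partial>M) \<le> (\<integral>\<^sup>+\<omega>. ennreal c * indicator E \<omega> \<partial>M)"
    using small by (intro nn_integral_mono) (auto simp: indicator_def ennreal_of_nat_eq_real_of_nat intro!: ennreal_leI)
  also have "\<dots> = ennreal (c * prob E)"
    using c by (simp add: nn_integral_cmult_indicator emeasure_eq_measure ennreal_mult)
  finally have "ennreal \<epsilon> * (\<integral>\<^sup>+\<omega>. of_nat (C k \<omega>) * indicator E \<omega> \<partial>M) \<le> ennreal \<epsilon> * ennreal (c * prob E)"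
    by (intro mult_left_mono) auto
  also have "\<dots> = ennreal ((\<epsilon> * c) * prob E)"
    using c by (simp add: ennreal_mult'[symmetric] mult_ac)
  also have "\<dots> \<le> ennreal (1 / 2 * prob E)"
    using c by (intro ennreal_leI mult_right_mono) auto
  finally show "(\<integral>\<^sup>+\<omega>. (\<Sum>i\<in>{1..k}. of_nat (N i (k + A) \<omega>)) * indicator E \<omega> \<partial>M) \<le> ennreal (prob E / 2)"
    using nn_integral_old_le[OF E contr] by (simp add: order_trans)
qed simp

section \<open>Times between visits\<close>

lemma source_sigma_past_mono:
  "s \<le> t \<Longrightarrow> E \<in> sets (source_sigma (past_sources s)) \<Longrightarrow> E \<in> sets (source_sigma (past_sources t))"
  by (rule subsetD[OF source_sigma_mono]) (auto simp: past_sources_def)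

lemma measurable_past_mono:
  assumes "s \<le> t" "X \<in> measurable (source_sigma (past_sources s)) L"
  shows "X \<in> measurable (source_sigma (past_sources t)) L"
proof (rule measurableI)
  show "X \<omega> \<in> space L" if "\<omega> \<in> space (source_sigma (past_sources t))" for \<omega>
    using measurable_space[OF assms(2), of \<omega>] that by (simp only: space_source_sigma)
  show "X -` Y \<inter> space (source_sigma (past_sources t)) \<in> sets (source_sigma (past_sources t))"
    if "Y \<in> sets L" for Y
    using source_sigma_past_mono[OF assms(1) measurable_sets[OF assms(2) that]]
    by (simp only: space_source_sigma)
qed

text \<open>The uniform decay condition, freed of the supremum and of the sequence \<open>g\<close>,
  and multiplied out.\<close>

definition contracting :: bool where
  "contracting \<longleftrightarrow> (\<forall>\<epsilon>>0. \<exists>A0. \<forall>A\<ge>A0. \<forall>i. w (i + A) \<le> \<epsilon> * w i)"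

text \<open>Only every \<open>A\<close>-th time after \<open>t\<close> is inspected, so visits in
  between may be missed. This can only overestimate the return time. For \<open>r = 0\<close> the
  set is \<open>E\<close>.\<close>

definition unvisited :: "nat \<Rightarrow> nat \<Rightarrow> nat \<Rightarrow> nat \<Rightarrow> 'w set \<Rightarrow> 'w set" where
  "unvisited m A t r E = {\<omega> \<in> E. \<forall>s\<in>{1..r}. C (t + s * A) \<omega> \<noteq> m}"

lemma unvisited_past:
  assumes "E \<in> sets (source_sigma (past_sources t))"
  shows "unvisited m A t r E \<in> sets (source_sigma (past_sources (t + r * A)))"
proof -
  have E: "E \<in> sets (source_sigma (past_sources (t + r * A)))"
    by (rule source_sigma_past_mono[OF _ assms]) simp
  have [measurable]: "s \<in> {1..r} \<Longrightarrow> C (t + s * A) \<in> measurable (source_sigma (past_sources (t + r * A))) (count_space UNIV)" for s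
    by (intro C_measurable_past) auto
  have "{\<omega> \<in> space (source_sigma (past_sources (t + r * A))). \<forall>s\<in>{1..r}. C (t + s * A) \<omega> \<noteq> m}
    \<in> sets (source_sigma (past_sources (t + r * A)))"
    by measurable
  from sets.Int[OF E this] have "E \<inter> {\<omega> \<in> space M. \<forall>s\<in>{1..r}. C (t + s * A) \<omega> \<noteq> m}
    \<in> sets (source_sigma (past_sources (t + r * A)))"
    by (simp only: space_source_sigma)
  also have "E \<inter> {\<omega> \<in> space M. \<forall>s\<in>{1..r}. C (t + s * A) \<omega> \<noteq> m} = unvisited m A t r E"
    using sets.sets_into_space[OF assms] by (auto simp: unvisited_def)
  finally show ?thesis .
qed

text \<open>Foster-Lyapunov argument: \<open>C + \<kappa>\<close>, restricted to the event that \<open>m\<close> has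
  not been visited yet, decreases in mean by the probability of that event.\<close>

lemma sum_prob_unvisited_le:
  assumes "contracting" "least_recurring_size \<Delta> f q D \<le> m"
  shows "\<exists>K\<ge>0. \<exists>A\<ge>1. \<forall>t. \<forall>E\<in>sets (source_sigma (past_sources t)). (\<forall>\<omega>\<in>E. C t \<omega> = m) \<longrightarrow>
    (\<Sum>r. ennreal (prob (unvisited m A t r E))) \<le> ennreal (K * prob E)"
proof -
  define T where "T = target"
  \<comment> \<open>Chosen such that a sample of size at most \<open>2 * (T + 1)\<close> leaves at
    most 1/2 survivors in mean, as needed for a hit, and such that at most a quarter of the mean
    survives.\<close>
  define \<epsilon> where "\<epsilon> = 1 / (4 * (T + 1))"
  have T: "0 \<le> T" using target_nonneg by (simp add: T_def)
  have \<epsilon>: "0 < \<epsilon>" "\<epsilon> \<le> 1 / 4" "\<epsilon> * (2 * (T + 1)) \<le> 1 / 2"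
    using T by (auto simp: \<epsilon>_def field_simps)
  obtain A1 where A1: "\<And>A i. A1 \<le> A \<Longrightarrow> w (i + A) \<le> \<epsilon> * w i"
    using assms(1) \<epsilon>(1) unfolding contracting_def by blast
  obtain A2 where A2: "\<And>A. A2 \<le> A \<Longrightarrow> \<exists>\<delta>>0. \<forall>t\<ge>A. \<delta> \<le> \<P>(\<omega> in M. (\<Sum>i\<in>{t - A<..t}. N i t \<omega>) = m)"
    using prob_recent_eq_bound[OF assms(2)] by blast
  \<comment> \<open>The lower bound 1 makes the inspected times strictly increasing.\<close>
  define A where "A = max 1 (max A1 A2)"
  have contr: "\<And>i. w (i + A) \<le> \<epsilon> * w i" using A1[of A] by (simp add: A_def)
  obtain \<delta>' where \<delta>': "0 < \<delta>'" "\<And>t. A \<le> t \<Longrightarrow> \<delta>' \<le> \<P>(\<omega> in M. (\<Sum>i\<in>{t - A<..t}. N i t \<omega>) = m)"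
    using A2[of A] unfolding A_def by (meson max.cobounded2 order_trans)
  define \<delta> where "\<delta> = \<delta>' / 2"
  \<comment> \<open>The weight makes a hit from a small sample pay for the arrivals, at most
    \<open>T\<close> in mean, and for the required decrease by 1.\<close>
  define \<kappa> where "\<kappa> = (T + 1) / \<delta>"
  have \<kappa>: "\<kappa> * \<delta> = T + 1" "0 < \<kappa>" using \<delta>'(1) T by (auto simp: \<kappa>_def \<delta>_def)
  have "(\<Sum>r. ennreal (prob (unvisited m A t r E))) \<le> ennreal ((real m + \<kappa>) * prob E)"
    if E: "E \<in> sets (source_sigma (past_sources t))" and Em: "\<And>\<omega>. \<omega> \<in> E \<Longrightarrow> C t \<omega> = m" for t E
  proof -
    define R where "R r = unvisited m A t r E" for r
    define I where "I r = (\<integral>\<^sup>+\<omega>. of_nat (C (t + r * A) \<omega>) * indicator (R r) \<omega> \<partial>M)" for r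
    define x where "x r = enn2real (I r)" for r
    have R: "R r \<in> sets (source_sigma (past_sources (t + r * A)))" for r
      unfolding R_def by (rule unvisited_past[OF E])
    have R_events [measurable]: "R r \<in> events" for r
      using R source_sigma_events[OF past_sources_subset] by blast
    have "I r \<le> ennreal target" for r
    proof -
      have "I r \<le> (\<integral>\<^sup>+\<omega>. of_nat (C (t + r * A) \<omega>) \<partial>M)"
        unfolding I_def by (intro nn_integral_mono) (simp add: indicator_def)
      then show ?thesis using nn_integral_C_le order_trans by blast
    qed
    then have I: "I r = ennreal (x r)" for r
      unfolding x_def by (metis ennreal_enn2real ennreal_less_top order_le_less_trans)
    have x_nonneg: "0 \<le> x r" for r by (simp add: x_def)
    have R_0: "R 0 = E" by (simp add: R_def unvisited_def)
    \<comment> \<open>On the part \<open>Q\<close> of small samples the loss of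
      \<open>\<kappa> * \<delta> = T + 1\<close> balances the books. On the rest the sample exceeds
      \<open>2 * (T + 1)\<close>, so \<open>T + 1\<close> times its probability is at most half of
      \<open>x r\<close>, and together with \<open>\<epsilon> * x r\<close> this stays below
      \<open>x r\<close>.\<close>
    have step: "x (Suc r) + \<kappa> * prob (R (Suc r)) + prob (R r) \<le> x r + \<kappa> * prob (R r)" for r
    proof -
      let ?k = "t + r * A"
      have k: "t + Suc r * A = ?k + A" by simp
      have R_Suc: "R (Suc r) = R r - {\<omega> \<in> space M. C (?k + A) \<omega> = m}"
      proof -
        have "{1..Suc r} = insert (Suc r) {1..r}" by auto
        then show ?thesis
          using sets.sets_into_space[OF E] by (auto simp: R_def unvisited_def add_ac)
      qed
      have "ennreal (x (Suc r)) \<le> (\<integral>\<^sup>+\<omega>. of_nat (C (?k + A) \<omega>) * indicator (R r) \<omega> \<partial>M)"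
        unfolding I[symmetric] I_def k R_Suc by (intro nn_integral_mono) (simp add: indicator_def)
      also have "\<dots> \<le> ennreal \<epsilon> * ennreal (x r) + ennreal (T * prob (R r))"
        using drift[OF R contr, of r] by (simp only: I_def[symmetric] I T_def)
      also have "\<dots> = ennreal (\<epsilon> * x r + T * prob (R r))"
        using \<epsilon> T x_nonneg[of r] by (simp add: ennreal_mult ennreal_plus)
      finally have x_Suc: "x (Suc r) \<le> \<epsilon> * x r + T * prob (R r)"
        by (subst (asm) ennreal_le_iff) (use \<epsilon> T x_nonneg[of r] in auto)
      define Q where "Q = R r \<inter> {\<omega> \<in> space M. real (C ?k \<omega>) \<le> 2 * (T + 1)}"
      have Q: "Q \<in> sets (source_sigma (past_sources ?k))"
      proof -
        note [measurable] = C_measurable_past[OF order_refl, of ?k]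
        have "{\<omega> \<in> space (source_sigma (past_sources ?k)). real (C ?k \<omega>) \<le> 2 * (T + 1)} \<in> sets (source_sigma (past_sources ?k))"
          by measurable
        from sets.Int[OF R this] show ?thesis by (simp only: Q_def space_source_sigma)
      qed
      have [measurable]: "Q \<in> events" unfolding Q_def by measurable
      have "\<delta>' \<le> \<P>(\<omega> in M. (\<Sum>i\<in>{?k<..?k + A}. N i (?k + A) \<omega>) = m)"
        using \<delta>'(2)[of "?k + A"] by (simp only: add_diff_cancel_right' le_add2)
      then have "\<delta>' / 2 * prob Q \<le> prob (Q \<inter> {\<omega> \<in> space M. C (?k + A) \<omega> = m})"
        using \<epsilon> T \<delta>'(1) by (intro prob_hit_ge[OF Q contr, where c = "2 * (T + 1)"]) (auto simp: Q_def)
      also have "\<dots> \<le> prob (R r \<inter> {\<omega> \<in> space M. C (?k + A) \<omega> = m})"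
        by (intro finite_measure_mono) (auto simp: Q_def)
      finally have hit: "\<delta> * prob Q \<le> prob (R r \<inter> {\<omega> \<in> space M. C (?k + A) \<omega> = m})"
        by (simp add: \<delta>_def)
      have "prob (R (Suc r)) = prob (R r) - prob (R r \<inter> {\<omega> \<in> space M. C (?k + A) \<omega> = m})"
      proof -
        have "R (Suc r) = R r - R r \<inter> {\<omega> \<in> space M. C (?k + A) \<omega> = m}" using R_Suc by blast
        then show ?thesis using finite_measure_Diff[of "R r" "R r \<inter> {\<omega> \<in> space M. C (?k + A) \<omega> = m}"] by simp
      qed
      then have p_Suc: "prob (R (Suc r)) \<le> prob (R r) - \<delta> * prob Q" using hit by simp
      have "ennreal (2 * (T + 1) * prob (R r - Q)) = (\<integral>\<^sup>+\<omega>. ennreal (2 * (T + 1)) * indicator (R r - Q) \<omega> \<partial>M)"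
        using T by (simp add: nn_integral_cmult_indicator emeasure_eq_measure ennreal_mult)
      also have "\<dots> \<le> I r"
        unfolding I_def
      proof (rule nn_integral_mono)
        fix \<omega> assume "\<omega> \<in> space M"
        then show "ennreal (2 * (T + 1)) * indicator (R r - Q) \<omega> \<le> of_nat (C ?k \<omega>) * indicator (R r) \<omega>"
          by (auto simp: indicator_def Q_def ennreal_of_nat_eq_real_of_nat intro!: ennreal_leI)
      qed
      finally have large: "2 * (T + 1) * prob (R r - Q) \<le> x r"
        unfolding I by (subst (asm) ennreal_le_iff) (use x_nonneg in auto)
      have split: "prob (R r) = prob Q + prob (R r - Q)"
        using finite_measure_Diff[of "R r" Q] by (simp add: Q_def)
      have "\<epsilon> * x r \<le> 1 / 4 * x r" using \<epsilon> x_nonneg[of r] by (intro mult_right_mono) auto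
      moreover have "\<kappa> * prob (R (Suc r)) \<le> \<kappa> * prob (R r) - (T + 1) * prob Q"
        using mult_left_mono[OF p_Suc, of \<kappa>] \<kappa> by (simp add: right_diff_distrib mult.assoc[symmetric])
      ultimately show ?thesis
        using x_Suc large split x_nonneg[of r] by (simp add: algebra_simps)
    qed
    have sum: "x r + \<kappa> * prob (R r) + (\<Sum>s<r. prob (R s)) \<le> x 0 + \<kappa> * prob (R 0)" for r
    proof (induction r)
      case (Suc r)
      then show ?case using step[of r] by simp
    qed simp
    \<comment> \<open>The chain starts at a visit, so the initial value is proportional to the
      probability of \<open>E\<close>; this yields a constant that depends neither on
      \<open>t\<close> nor on \<open>E\<close>.\<close>
    have "I 0 = (\<integral>\<^sup>+\<omega>. ennreal (real m) * indicator E \<omega> \<partial>M)"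
      unfolding I_def R_0 using Em
      by (intro nn_integral_cong) (auto simp: indicator_def ennreal_of_nat_eq_real_of_nat)
    also have "\<dots> = ennreal (real m * prob E)"
      using R_events[of 0] by (simp add: nn_integral_cmult_indicator emeasure_eq_measure ennreal_mult R_0)
    finally have x_0: "x 0 = real m * prob E"
      unfolding I by (subst (asm) ennreal_inj) (use x_nonneg in auto)
    have "(\<Sum>s<r. ennreal (prob (R s))) \<le> ennreal ((real m + \<kappa>) * prob E)" for r
    proof -
      have "0 \<le> \<kappa> * prob (R r)" using \<kappa> by simp
      then have "(\<Sum>s<r. prob (R s)) \<le> (real m + \<kappa>) * prob E"
        using sum[of r] x_nonneg[of r] by (simp add: x_0 R_0 distrib_right)
      then show ?thesis by (simp add: ennreal_leI)
    qed
    then show ?thesis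
      unfolding suminf_eq_SUP R_def by (intro SUP_least)
  qed
  moreover have "1 \<le> A" by (simp add: A_def)
  ultimately show ?thesis
    using \<kappa>(2) by (intro exI[of _ "real m + \<kappa>"] conjI exI[of _ A]) auto
qed

text \<open>The stopping time property: by \<open>Inf_enat_eq_iff\<close> and
  \<open>less_enat_iff\<close>, the event is decided by sizes up to \<open>t\<close> and by earlier
  values of the previous visit time.\<close>

lemma visit_time_past:
  "Measurable.pred (source_sigma (past_sources t)) (\<lambda>\<omega>. visit_time (\<lambda>k. C k \<omega>) m j = enat t)"
proof (induction j arbitrary: t)
  case 0
  have [measurable]: "s \<le> t \<Longrightarrow> C s \<in> measurable (source_sigma (past_sources t)) (count_space UNIV)" for s
    by (rule C_measurable_past)
  show ?case by (simp only: visit_time.simps Inf_enat_eq_iff) measurable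
next
  case (Suc j)
  have [measurable]: "s \<le> t \<Longrightarrow> C s \<in> measurable (source_sigma (past_sources t)) (count_space UNIV)" for s
    by (rule C_measurable_past)
  have [measurable]: "u \<le> t \<Longrightarrow> Measurable.pred (source_sigma (past_sources t)) (\<lambda>\<omega>. visit_time (\<lambda>k. C k \<omega>) m j = enat u)" for u
    by (rule measurable_past_mono[OF _ Suc])
  show ?case
    by (simp only: visit_time.simps Inf_enat_eq_iff less_enat_iff) measurable
qed

text \<open>If the first inspected visit is the one with number \<open>s\<close>, then the gap is at
  most \<open>s * A\<close>, and exactly the sets with \<open>r < s\<close> contain the outcome.
  Without such a visit all indicators are 1 and the bound is infinite.\<close>

lemma visit_gap_le:
  assumes "visit_time (\<lambda>k. C k \<omega>) m j = enat t" "\<omega> \<in> E" "1 \<le> A"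
  shows "ennreal_of_enat (visit_time (\<lambda>k. C k \<omega>) m (Suc j) - visit_time (\<lambda>k. C k \<omega>) m j) \<le>
    (\<Sum>r. of_nat A * indicator (unvisited m A t r E) \<omega>)"
proof (cases "\<exists>s\<ge>1. C (t + s * A) \<omega> = m")
  case True
  define s where "s = (LEAST s. 1 \<le> s \<and> C (t + s * A) \<omega> = m)"
  have s: "1 \<le> s" "C (t + s * A) \<omega> = m"
    using LeastI_ex[OF True[simplified Bex_def[symmetric]], folded s_def] by auto
  have less: "\<omega> \<in> unvisited m A t r E" if "r < s" for r
    unfolding unvisited_def
  proof (intro CollectI conjI ballI assms(2))
    fix s' assume "s' \<in> {1..r}"
    then show "C (t + s' * A) \<omega> \<noteq> m"
      using that not_less_Least[of s' "\<lambda>s. 1 \<le> s \<and> C (t + s * A) \<omega> = m"] by (simp add: s_def)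
  qed
  have "visit_time (\<lambda>k. C k \<omega>) m (Suc j) - visit_time (\<lambda>k. C k \<omega>) m j \<le> enat (s * A)"
    using s assms by (intro visit_time_Suc_le) auto
  then have "ennreal_of_enat (visit_time (\<lambda>k. C k \<omega>) m (Suc j) - visit_time (\<lambda>k. C k \<omega>) m j) \<le> of_nat (s * A)"
    by (metis ennreal_of_enat_enat ennreal_of_enat_le_iff)
  also have "of_nat (s * A) = (\<Sum>r<s. of_nat A * indicator (unvisited m A t r E) \<omega> :: ennreal)"
    using less by simp
  also have "\<dots> \<le> (\<Sum>r. of_nat A * indicator (unvisited m A t r E) \<omega>)"
    by (intro sum_le_suminf) auto
  finally show ?thesis .
next
  case False
  then have *: "\<omega> \<in> unvisited m A t r E" for r using assms(2) by (auto simp: unvisited_def)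
  have "(of_nat n :: ennreal) \<le> (\<Sum>r. of_nat A * indicator (unvisited m A t r E) \<omega>)" for n
  proof -
    have "(of_nat n :: ennreal) \<le> of_nat (n * A)" using assms(3) by (intro of_nat_mono) simp
    also have "\<dots> = (\<Sum>r<n. of_nat A * indicator (unvisited m A t r E) \<omega>)" using * by simp
    also have "\<dots> \<le> (\<Sum>r. of_nat A * indicator (unvisited m A t r E) \<omega>)"
      by (intro sum_le_suminf) auto
    finally show ?thesis .
  qed
  then have "(\<Sum>r. of_nat A * indicator (unvisited m A t r E) \<omega>) = (top :: ennreal)"
    by (metis ennreal_Ex_less_of_nat leD top.not_eq_extremum)
  then show ?thesis by simp
qed

text \<open>Split by the value \<open>t\<close> of the previous visit time. The bound on each piece
  is proportional to its probability, and the pieces are disjoint, so the total does not depend on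
  \<open>j\<close>.\<close>

lemma visit_gap_bounded:
  assumes "contracting" and m: "least_recurring_size \<Delta> f q D \<le> m"
  shows "(SUP j. \<integral>\<^sup>+\<omega>. ennreal_of_enat
    (visit_time (\<lambda>k. C k \<omega>) m (Suc j) - visit_time (\<lambda>k. C k \<omega>) m j) \<partial>M) < \<infinity>"
proof -
  obtain K A where K: "0 \<le> K" and A: "1 \<le> A" and bound:
    "\<And>t E. E \<in> sets (source_sigma (past_sources t)) \<Longrightarrow> (\<And>\<omega>. \<omega> \<in> E \<Longrightarrow> C t \<omega> = m) \<Longrightarrow>
      (\<Sum>r. ennreal (prob (unvisited m A t r E))) \<le> ennreal (K * prob E)"
    using sum_prob_unvisited_le[OF assms] by metis
  have "(\<integral>\<^sup>+\<omega>. ennreal_of_enat (visit_time (\<lambda>k. C k \<omega>) m (Suc j) - visit_time (\<lambda>k. C k \<omega>) m j) \<partial>M)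
      \<le> of_nat A * ennreal K" for j
  proof -
    define E where "E t = {\<omega> \<in> space M. visit_time (\<lambda>k. C k \<omega>) m j = enat t}" for t
    let ?U = "\<lambda>t r. unvisited m A t r (E t)"
    have E: "E t \<in> sets (source_sigma (past_sources t))" for t
      using visit_time_past[where t = t and m = m and j = j] by (simp add: pred_def E_def)
    have [measurable]: "E t \<in> events" for t
      using E source_sigma_events[OF past_sources_subset] by blast
    have [measurable]: "?U t r \<in> events" for t r
      using unvisited_past[OF E] source_sigma_events[OF past_sources_subset] by blast
    have Em: "C t \<omega> = m" if "\<omega> \<in> E t" for t \<omega>
      using that visit_time_value[of "\<lambda>k. C k \<omega>" m j t] by (simp add: E_def)
    \<comment> \<open>Where the previous visit does not take place, the gap is \<infinity> by
      convention and no \<open>E t\<close> covers the outcome; recurrence makes this a null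
      set.\<close>
    have "AE \<omega> in M. \<exists>\<^sub>\<infinity>k. C k \<omega> = m"
      using prob_infinitely_often[OF m] prob_Collect_eq_1[of "\<lambda>\<omega>. \<exists>\<^sub>\<infinity>k. C k \<omega> = m"]
      by (simp add: INFM_nat_le)
    then have "AE \<omega> in M. ennreal_of_enat (visit_time (\<lambda>k. C k \<omega>) m (Suc j) - visit_time (\<lambda>k. C k \<omega>) m j)
      \<le> (\<Sum>t. \<Sum>r. of_nat A * indicator (?U t r) \<omega>)"
    proof (rule AE_mp, intro AE_I2 impI)
      fix \<omega> assume "\<omega> \<in> space M" "\<exists>\<^sub>\<infinity>k. C k \<omega> = m"
      then obtain t where t: "visit_time (\<lambda>k. C k \<omega>) m j = enat t"
        using visit_time_finite[of "\<lambda>k. C k \<omega>" m j] by auto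
      then have "ennreal_of_enat (visit_time (\<lambda>k. C k \<omega>) m (Suc j) - visit_time (\<lambda>k. C k \<omega>) m j) \<le>
          (\<Sum>r. of_nat A * indicator (?U t r) \<omega>)"
        using \<open>\<omega> \<in> space M\<close> A by (intro visit_gap_le) (auto simp: E_def)
      also have "\<dots> \<le> (\<Sum>t. \<Sum>r. of_nat A * indicator (?U t r) \<omega>)"
        using sum_le_suminf[of "\<lambda>t. \<Sum>r. of_nat A * indicator (?U t r) \<omega> :: ennreal" "{t}"] by simp
      finally show "ennreal_of_enat (visit_time (\<lambda>k. C k \<omega>) m (Suc j) - visit_time (\<lambda>k. C k \<omega>) m j)
        \<le> (\<Sum>t. \<Sum>r. of_nat A * indicator (?U t r) \<omega>)" .
    qed
    then have "(\<integral>\<^sup>+\<omega>. ennreal_of_enat (visit_time (\<lambda>k. C k \<omega>) m (Suc j) - visit_time (\<lambda>k. C k \<omega>) m j) \<partial>M)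
      \<le> (\<integral>\<^sup>+\<omega>. (\<Sum>t. \<Sum>r. of_nat A * indicator (?U t r) \<omega>) \<partial>M)"
      by (rule nn_integral_mono_AE)
    also have "\<dots> = (\<Sum>t. \<Sum>r. of_nat A * ennreal (prob (?U t r)))"
      by (simp add: nn_integral_suminf nn_integral_cmult emeasure_eq_measure)
    also have "\<dots> \<le> (\<Sum>t. of_nat A * ennreal K * ennreal (prob (E t)))"
    proof (intro suminf_le summableI)
      fix t
      have "(\<Sum>r. of_nat A * ennreal (prob (?U t r))) = of_nat A * (\<Sum>r. ennreal (prob (?U t r)))"
        by simp
      also have "\<dots> \<le> of_nat A * ennreal (K * prob (E t))"
        by (intro mult_left_mono bound[OF E] Em) auto
      finally show "(\<Sum>r. of_nat A * ennreal (prob (?U t r))) \<le> of_nat A * ennreal K * ennreal (prob (E t))"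
        using K by (simp add: ennreal_mult mult.assoc)
    qed
    also have "\<dots> = of_nat A * ennreal K * (\<Sum>t. emeasure M (E t))"
      by (simp add: emeasure_eq_measure)
    also have "(\<Sum>t. emeasure M (E t)) = emeasure M (\<Union>t. E t)"
    proof (rule suminf_emeasure)
      show "disjoint_family E" by (auto simp: disjoint_family_on_def E_def)
    qed auto
    also have "of_nat A * ennreal K * emeasure M (\<Union>t. E t) \<le> of_nat A * ennreal K * 1"
      by (intro mult_left_mono measure_le_1) auto
    finally show ?thesis by simp
  qed
  then have "(SUP j. \<integral>\<^sup>+\<omega>. ennreal_of_enat
      (visit_time (\<lambda>k. C k \<omega>) m (Suc j) - visit_time (\<lambda>k. C k \<omega>) m j) \<partial>M) \<le> of_nat A * ennreal K"
    by (rule SUP_least)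
  also have "\<dots> < \<infinity>" by (simp add: ennreal_mult_less_top ennreal_of_nat_eq_real_of_nat)
  finally show ?thesis .
qed

section \<open>The time average\<close>

lemma contractingI:
  assumes g: "g \<longlonglongrightarrow> 0"
    and le: "\<forall>k\<ge>1. (SUP i. f (real (i + k) * \<Delta>) / f (real i * \<Delta>)) \<le> g k"
  shows contracting
  unfolding contracting_def
proof (intro allI impI)
  fix \<epsilon> :: real assume "0 < \<epsilon>"
  then have "eventually (\<lambda>k. g k < \<epsilon>) sequentially" using g by (intro order_tendstoD(2)) auto
  then obtain A0 where A0: "\<And>k. A0 \<le> k \<Longrightarrow> g k < \<epsilon>" by (auto simp: eventually_sequentially)
  have "w (i + A) \<le> \<epsilon> * w i" if "max 1 A0 \<le> A" for A i
  proof -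
    \<comment> \<open>A real supremum bounds its members only if the set is bounded above;
      monotonicity of the decay provides this.\<close>
    have "w (i + A) / w i \<le> 1" for i
      using w_antimono[of i "i + A"] w_pos[of i] by simp
    then have "bdd_above (range (\<lambda>i. w (i + A) / w i))" by (intro bdd_aboveI[where M = 1]) auto
    then have "w (i + A) / w i \<le> (SUP i. w (i + A) / w i)" by (intro cSUP_upper) auto
    also have "\<dots> \<le> g A" using le that by simp
    also have "\<dots> \<le> \<epsilon>" using A0[of A] that by simp
    finally show ?thesis using w_pos[of i] by (simp only: pos_divide_le_eq)
  qed
  then show "\<exists>A0. \<forall>A\<ge>A0. \<forall>i. w (i + A) \<le> \<epsilon> * w i" by blast
qed

text \<open>A shift by \<open>A\<close> halves the decay values, so each partial sum is at most a
  constant plus half of itself and is therefore bounded.\<close>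

lemma summable_weighted:
  assumes contracting shows "summable (\<lambda>a. real (Suc a) * w a)"
proof -
  have "\<exists>A0. \<forall>A\<ge>A0. \<forall>i. w (i + A) \<le> 1 / 2 * w i"
    using assms unfolding contracting_def by (rule allE[where x = "1 / 2"]) simp
  then obtain A where A: "\<And>i. w (i + A) \<le> 1 / 2 * w i" by blast
  let ?S = "\<lambda>n. \<Sum>a<n. real (Suc a) * w a"
  have nonneg: "0 \<le> real (Suc a) * w a" for a using w_pos[of a] by simp
  have "?S n \<le> 2 * ?S A + real A * (\<Sum>a. w a)" for n
  proof -
    have "?S n \<le> ?S (A + n)" by (intro sum_mono2 nonneg) auto
    also have "\<dots> = ?S A + (\<Sum>a<n. real (Suc (a + A)) * w (a + A))"
      using sum.atLeastLessThan_concat[of 0 A "A + n" "\<lambda>a. real (Suc a) * w a"]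
        sum.shift_bounds_nat_ivl[of "\<lambda>a. real (Suc a) * w a" 0 A n]
      by (simp add: atLeast0LessThan add.commute)
    also have "(\<Sum>a<n. real (Suc (a + A)) * w (a + A)) \<le> (\<Sum>a<n. real (Suc (a + A)) * (1 / 2 * w a))"
      by (intro sum_mono mult_left_mono A) auto
    also have "\<dots> = 1 / 2 * ?S n + real A / 2 * (\<Sum>a<n. w a)"
      unfolding sum_distrib_left sum.distrib[symmetric] by (intro sum.cong refl) (simp add: field_simps)
    also have "real A / 2 * (\<Sum>a<n. w a) \<le> real A / 2 * (\<Sum>a. w a)"
      by (intro mult_left_mono sum_w_le) simp
    finally show ?thesis by simp
  qed
  then show ?thesis by (intro summableI_nonneg_bounded nonneg)
qed

lemma N_integral:
  assumes "1 \<le> i" "i \<le> t"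
  shows "integrable M (\<lambda>\<omega>. real (N i t \<omega>))" "expectation (\<lambda>\<omega>. real (N i t \<omega>)) = q * mean_size * w (t - i)"
proof -
  note [measurable] = N_rv[OF assms]
  have "(\<integral>\<^sup>+\<omega>. ennreal (real (N i t \<omega>)) \<partial>M) = ennreal (q * mean_size * w (t - i))"
    using nn_integral_N[OF assms] by (simp add: ennreal_of_nat_eq_real_of_nat)
  moreover have "0 \<le> q * mean_size * w (t - i)"
    by (intro mult_nonneg_nonneg mean_size_nonneg less_imp_le[OF q_pos] less_imp_le[OF w_pos])
  ultimately have "integrable M (\<lambda>\<omega>. real (N i t \<omega>)) \<and> expectation (\<lambda>\<omega>. real (N i t \<omega>)) = q * mean_size * w (t - i)"
    by (subst nn_integral_eq_integrable[symmetric]) auto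
  then show "integrable M (\<lambda>\<omega>. real (N i t \<omega>))" "expectation (\<lambda>\<omega>. real (N i t \<omega>)) = q * mean_size * w (t - i)"
    by auto
qed

lemma AE_N_le:
  assumes "\<forall>x\<in>set_pmf D. x \<le> c" "1 \<le> i"
  shows "AE \<omega> in M. \<forall>t. N i t \<omega> \<le> c"
proof -
  have "AE x in distr M (count_space UNIV) (B i). x \<le> c"
    unfolding batch_size[OF assms(2)] using assms(1) by (simp add: AE_measure_pmf_iff)
  then have "AE \<omega> in M. B i \<omega> \<le> c"
    using B_rv[OF assms(2)] by (simp add: AE_distr_iff)
  then show ?thesis
  proof eventually_elim
    case (elim \<omega>)
    have "N i t \<omega> \<le> card {..<B i \<omega>}" for t unfolding N_def by (intro card_mono) auto
    then show ?case using elim by (auto intro: order_trans)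
  qed
qed

text \<open>The time that the items of batch \<open>i\<close> spend in the sample up to time
  \<open>k\<close>, counted with multiplicity; the ages run from 0 to \<open>k - i\<close>, hence
  \<open>Suc k - i\<close> terms.\<close>

definition occupation :: "nat \<Rightarrow> nat \<Rightarrow> 'w \<Rightarrow> real" where
  "occupation i k \<omega> = (\<Sum>a<Suc k - i. real (N i (i + a) \<omega>))"

text \<open>Exchange of summation over times and batches. The sizes at different times are
  dependent, whereas the summands on the right are independent.\<close>

lemma sum_C_eq: "(\<Sum>t=0..k. real (C t \<omega>)) = (\<Sum>i\<in>{1..k}. occupation i k \<omega>)"
proof -
  have "(\<Sum>t=0..k. real (C t \<omega>)) = (\<Sum>t\<in>{0..k}. \<Sum>i | i \<in> {1..k} \<and> i \<le> t. real (N i t \<omega>))"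
    unfolding sample_size_eq of_nat_sum by (intro sum.cong) auto
  also have "\<dots> = (\<Sum>i\<in>{1..k}. \<Sum>t | t \<in> {0..k} \<and> i \<le> t. real (N i t \<omega>))"
    by (rule sum.swap_restrict) auto
  also have "\<dots> = (\<Sum>i\<in>{1..k}. occupation i k \<omega>)"
    unfolding occupation_def
  proof (rule sum.cong[OF refl])
    fix i show "(\<Sum>t | t \<in> {0..k} \<and> i \<le> t. real (N i t \<omega>)) = (\<Sum>a<Suc k - i. real (N i (i + a) \<omega>))"
      by (rule sum.reindex_bij_witness[of _ "\<lambda>a. i + a" "\<lambda>t. t - i"]) auto
  qed
  finally show ?thesis .
qed

lemma occupation_measurable:
  "1 \<le> i \<Longrightarrow> occupation i k \<in> borel_measurable (source_sigma (batch_sources {i}))"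
proof -
  assume "1 \<le> i"
  then have [measurable]: "N i (i + a) \<in> measurable (source_sigma (batch_sources {i})) (count_space UNIV)" for a
    by (intro N_measurable_batch) auto
  show ?thesis unfolding occupation_def[abs_def] by measurable
qed

lemma occupation_rv: "1 \<le> i \<Longrightarrow> random_variable borel (occupation i k)"
  by (rule measurable_source_sigma_M[OF batch_sources_subset occupation_measurable])

lemma occupation_indep:
  assumes "1 \<le> i" "1 \<le> j" "i \<noteq> j"
  shows "indep_var borel (occupation i k) borel (occupation j k)"
proof -
  have sub: "sigma_sets (space M) {occupation i k -` A \<inter> space M |A. A \<in> sets borel} \<subseteq> sets (source_sigma (batch_sources {i}))"
    if "1 \<le> i" for i
  proof -
    have "{occupation i k -` A \<inter> space M |A. A \<in> sets borel} \<subseteq> sets (source_sigma (batch_sources {i}))"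
      using measurable_sets[OF occupation_measurable[OF that]] by (auto simp only: space_source_sigma)
    then show ?thesis
      using sets.sigma_sets_subset[of _ "source_sigma (batch_sources {i})"] by (simp only: space_source_sigma)
  qed
  show ?thesis
    unfolding indep_var_eq
  proof (intro conjI occupation_rv assms indep_setI)
    fix a b assume "a \<in> sigma_sets (space M) {occupation i k -` A \<inter> space M |A. A \<in> sets borel}"
      "b \<in> sigma_sets (space M) {occupation j k -` A \<inter> space M |A. A \<in> sets borel}"
    then have "a \<in> sets (source_sigma (batch_sources {i}))" "b \<in> sets (source_sigma (batch_sources {j}))"
      using sub assms by blast+
    moreover have "batch_sources {i} \<inter> batch_sources {j} = {}" using assms by (auto simp: batch_sources_def)
    ultimately show "prob (a \<inter> b) = prob a * prob b"
      by (intro prob_Int_source_sigma[OF batch_sources_subset batch_sources_subset])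
  qed (use sub assms source_sigma_events[OF batch_sources_subset] in blast)+
qed

lemma occupation_integral:
  assumes "1 \<le> i"
  shows "integrable M (occupation i k)"
    "expectation (occupation i k) = q * mean_size * (\<Sum>a<Suc k - i. w a)"
proof -
  have *: "integrable M (\<lambda>\<omega>. real (N i (i + a) \<omega>))" "expectation (\<lambda>\<omega>. real (N i (i + a) \<omega>)) = q * mean_size * w a" for a
    using N_integral[of i "i + a"] assms by auto
  show "integrable M (occupation i k)"
    unfolding occupation_def[abs_def] using * by (intro Bochner_Integration.integrable_sum) auto
  show "expectation (occupation i k) = q * mean_size * (\<Sum>a<Suc k - i. w a)"
    unfolding occupation_def using * by (subst Bochner_Integration.integral_sum) (auto simp: sum_distrib_left)
qed

text \<open>Each \<open>N i t\<close> is at most \<open>c\<close>, so \<open>square_sum_le\<close>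
  reduces the claim to age-weighted means, whose series converges by
  \<open>summable_weighted\<close>. The bound is uniform in \<open>i\<close> and
  \<open>k\<close>.\<close>

lemma occupation_second_moment:
  assumes c: "\<forall>x\<in>set_pmf D. x \<le> c" and "contracting" "1 \<le> i"
  shows "integrable M (\<lambda>\<omega>. (occupation i k \<omega>)\<^sup>2)"
    "expectation (\<lambda>\<omega>. (occupation i k \<omega>)\<^sup>2) \<le> 2 * real c * (q * mean_size * (\<Sum>a. real (Suc a) * w a))"
proof -
  note [measurable] = occupation_rv[OF \<open>1 \<le> i\<close>]
  let ?n = "Suc k - i"
  have *: "integrable M (\<lambda>\<omega>. real (N i (i + a) \<omega>))" "expectation (\<lambda>\<omega>. real (N i (i + a) \<omega>)) = q * mean_size * w a" for a
    using N_integral[of i "i + a"] assms by auto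
  let ?G = "\<lambda>\<omega>. 2 * real c * (\<Sum>a<?n. real (Suc a) * real (N i (i + a) \<omega>))"
  have G: "integrable M ?G"
    using * by (intro integrable_mult_right Bochner_Integration.integrable_sum) auto
  have le: "AE \<omega> in M. (occupation i k \<omega>)\<^sup>2 \<le> ?G \<omega>"
    using AE_N_le[OF c \<open>1 \<le> i\<close>]
  proof eventually_elim
    case (elim \<omega>)
    then show ?case unfolding occupation_def by (intro square_sum_le) auto
  qed
  show int: "integrable M (\<lambda>\<omega>. (occupation i k \<omega>)\<^sup>2)"
    by (rule Bochner_Integration.integrable_bound[OF G]) (use le in auto)
  have "expectation (\<lambda>\<omega>. (occupation i k \<omega>)\<^sup>2) \<le> expectation ?G"
    by (rule integral_mono_AE[OF int G le])
  also have "\<dots> = 2 * real c * (\<Sum>a<?n. real (Suc a) * (q * mean_size * w a))"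
    using * by (simp add: Bochner_Integration.integral_sum)
  also have "\<dots> = 2 * real c * (q * mean_size * (\<Sum>a<?n. real (Suc a) * w a))"
    by (simp add: sum_distrib_left mult_ac)
  also have "\<dots> \<le> 2 * real c * (q * mean_size * (\<Sum>a. real (Suc a) * w a))"
    using q_pos mean_size_nonneg w_pos
    by (intro mult_left_mono sum_le_suminf summable_weighted assms(2)) (auto intro: less_imp_le)
  finally show "expectation (\<lambda>\<omega>. (occupation i k \<omega>)\<^sup>2) \<le> 2 * real c * (q * mean_size * (\<Sum>a. real (Suc a) * w a))" .
qed

text \<open>Truncation at time \<open>k\<close> shortens the occupation of late batches. By
  \<open>sum_partial_sums\<close> the total deficit involves only the partial sums of the convergent
  series of \<open>real a * w a\<close>, and it vanishes after division by \<open>k\<close>.\<close>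

lemma mean_average_tendsto:
  assumes "contracting"
  shows "(\<lambda>k. (\<Sum>i\<in>{1..k}. expectation (occupation i k)) / real k) \<longlonglongrightarrow> target"
proof -
  have summable: "summable (\<lambda>a. real a * w a)"
    using summable_weighted[OF assms] w_pos
    by (rule_tac summable_comparison_test'[where N = 0]) (auto intro!: mult_right_mono simp: less_imp_le)
  have "(\<Sum>i\<in>{1..k}. expectation (occupation i k)) =
      q * mean_size * (real k * (\<Sum>a<k. w a) - (\<Sum>a<k. real a * w a))" for k
  proof -
    have "(\<Sum>i\<in>{1..k}. expectation (occupation i k)) = (\<Sum>i\<in>{1..k}. q * mean_size * (\<Sum>a<Suc k - i. w a))"
      by (intro sum.cong) (auto simp: occupation_integral)
    also have "\<dots> = q * mean_size * (\<Sum>j<k. \<Sum>a<Suc j. w a)"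
      unfolding sum_distrib_left[symmetric]
      by (rule arg_cong[of _ _ "(*) (q * mean_size)"],
          rule sum.reindex_bij_witness[of _ "\<lambda>j. k - j" "\<lambda>i. k - i"]) (auto simp: Suc_diff_le)
    finally show ?thesis by (simp only: sum_partial_sums)
  qed
  then have eq: "(\<Sum>i\<in>{1..k}. expectation (occupation i k)) / real k =
      q * mean_size * ((\<Sum>a<k. w a) - (\<Sum>a<k. real a * w a) * inverse (real k))" if "0 < k" for k
    using that by (simp add: field_simps)
  have "(\<lambda>k. q * mean_size * ((\<Sum>a<k. w a) - (\<Sum>a<k. real a * w a) * inverse (real k))) \<longlonglongrightarrow>
      q * mean_size * ((\<Sum>a. w a) - (\<Sum>a. real a * w a) * 0)"
    by (intro tendsto_intros summable_LIMSEQ w_summable summable lim_inverse_n)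
  then show ?thesis
    unfolding target_def mult_zero_right diff_zero
    by (rule Lim_transform_eventually) (use eventually_gt_at_top[of 0] in eventually_elim, simp only: eq)
qed

lemma AE_average_tendsto:
  assumes "max_batch_size D < \<infinity>" "contracting"
  shows "AE \<omega> in M. (\<lambda>k. (1 / real k) * (\<Sum>t=0..k. real (C t \<omega>))) \<longlonglongrightarrow> target"
proof -
  obtain c where c: "\<forall>x\<in>set_pmf D. x \<le> c" using max_batch_size_finite[OF assms(1)] .
  define V where "V = 2 * real c * (q * mean_size * (\<Sum>a. real (Suc a) * w a))"
  define S where "S k \<omega> = (\<Sum>i\<in>{1..k}. occupation i k \<omega>)" for k \<omega>
  define E where "E k = (\<Sum>i\<in>{1..k}. expectation (occupation i k))" for k
  have S_rv [measurable]: "random_variable borel (S k)" for k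
    unfolding S_def by (intro borel_measurable_sum occupation_rv) auto
  have moment: "integrable M (\<lambda>\<omega>. (S k \<omega> - E k)\<^sup>2)" "expectation (\<lambda>\<omega>. (S k \<omega> - E k)\<^sup>2) \<le> real k * V" for k
  proof -
    note sm = second_moment_sum_centered_indep[of "{1..k}" "\<lambda>i. occupation i k"]
    show "integrable M (\<lambda>\<omega>. (S k \<omega> - E k)\<^sup>2)"
      unfolding S_def E_def
      by (rule sm(1)) (auto intro!: occupation_integral occupation_second_moment[OF c assms(2)] occupation_indep)
    have "expectation (\<lambda>\<omega>. (S k \<omega> - E k)\<^sup>2) \<le> (\<Sum>i\<in>{1..k}. expectation (\<lambda>\<omega>. (occupation i k \<omega>)\<^sup>2))"
      unfolding S_def E_def
      by (rule sm(2)) (auto intro!: occupation_integral occupation_second_moment[OF c assms(2)] occupation_indep)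
    also have "\<dots> \<le> (\<Sum>i\<in>{1..k}. V)"
      unfolding V_def by (intro sum_mono occupation_second_moment[OF c assms(2)]) auto
    finally show "expectation (\<lambda>\<omega>. (S k \<omega> - E k)\<^sup>2) \<le> real k * V" by simp
  qed
  let ?s = "\<lambda>r::nat. (Suc r)\<^sup>2"
  let ?D = "\<lambda>r \<omega>. ((S (?s r) \<omega> - E (?s r)) / real (?s r))\<^sup>2"
  \<comment> \<open>Dividing the variance bound \<open>real k * V\<close> by the square of
    \<open>k\<close> leaves \<open>V / k\<close>, which is summable along squares. Thus the series
    of squared deviations has finite mean, so it is finite almost surely and its terms tend to
    0.\<close>
  have "(\<integral>\<^sup>+\<omega>. ennreal (?D r \<omega>) \<partial>M) \<le> ennreal (V * inverse (real (Suc r) ^ 2))" for r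
  proof -
    have "(\<integral>\<^sup>+\<omega>. ennreal (?D r \<omega>) \<partial>M) = ennreal (expectation (?D r))"
      by (rule nn_integral_eq_integral) (auto simp: power_divide moment simp del: of_nat_Suc of_nat_power)
    also have "expectation (?D r) = expectation (\<lambda>\<omega>. (S (?s r) \<omega> - E (?s r))\<^sup>2) / (real (?s r))\<^sup>2"
      by (simp add: power_divide del: of_nat_Suc of_nat_power)
    also have "\<dots> \<le> (real (?s r) * V) / (real (?s r))\<^sup>2"
      by (intro divide_right_mono moment) simp
    also have "\<dots> = V * inverse (real (Suc r) ^ 2)"
    proof -
      have "(x * V) / x\<^sup>2 = V * inverse x" if "0 < x" for x :: real
        using that by (simp add: power2_eq_square field_simps)
      moreover have "0 < real (Suc r) ^ 2" by simp
      ultimately show ?thesis unfolding of_nat_power by blast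
    qed
    finally show ?thesis by (simp add: ennreal_leI)
  qed
  moreover have sum_eq: "(\<Sum>r. \<integral>\<^sup>+\<omega>. ennreal (?D r \<omega>) \<partial>M) = (\<integral>\<^sup>+\<omega>. (\<Sum>r. ennreal (?D r \<omega>)) \<partial>M)"
    by (rule nn_integral_suminf[symmetric]) measurable
  ultimately have "(\<Sum>r. \<integral>\<^sup>+\<omega>. ennreal (?D r \<omega>) \<partial>M) \<le> (\<Sum>r. ennreal (V * inverse (real (Suc r) ^ 2)))"
    by (intro suminf_le summableI)
  also have "\<dots> < \<infinity>"
  proof -
    have "0 \<le> V"
      unfolding V_def using q_pos mean_size_nonneg w_pos
      by (intro mult_nonneg_nonneg suminf_nonneg summable_weighted assms(2)) (auto intro: less_imp_le)
    moreover have "summable (\<lambda>r. V * inverse (real (Suc r) ^ 2))"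
      by (intro summable_mult summable_Suc_iff[THEN iffD2] inverse_power_summable) simp
    ultimately have "(\<Sum>r. ennreal (V * inverse (real (Suc r) ^ 2))) = ennreal (\<Sum>r. V * inverse (real (Suc r) ^ 2))"
      by (intro suminf_ennreal2 mult_nonneg_nonneg) auto
    then show ?thesis by (simp only: ennreal_less_top infinity_ennreal_def)
  qed
  finally have "(\<integral>\<^sup>+\<omega>. (\<Sum>r. ennreal (?D r \<omega>)) \<partial>M) \<noteq> \<infinity>"
    unfolding sum_eq[symmetric] by (rule less_imp_neq)
  then have "AE \<omega> in M. (\<Sum>r. ennreal (?D r \<omega>)) \<noteq> \<infinity>"
    by (rule nn_integral_noteq_infinite[rotated]) measurable
  then show ?thesis
  proof eventually_elim
    case (elim \<omega>)
    have "summable (\<lambda>r. ?D r \<omega>)"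
      using elim by (intro summable_suminf_not_top) auto
    then have "(\<lambda>r. ?D r \<omega>) \<longlonglongrightarrow> 0" by (rule summable_LIMSEQ_zero)
    then have "(\<lambda>r. sqrt (?D r \<omega>)) \<longlonglongrightarrow> sqrt 0" by (intro tendsto_real_sqrt)
    then have dev: "(\<lambda>r. (S (?s r) \<omega> - E (?s r)) / real (?s r)) \<longlonglongrightarrow> 0"
      by (simp only: real_sqrt_abs real_sqrt_zero tendsto_rabs_zero_iff)
    have "filterlim ?s at_top sequentially"
      by (rule filterlim_at_top_mono[OF filterlim_Suc]) (auto simp: power2_eq_square)
    then have "(\<lambda>r. E (?s r) / real (?s r)) \<longlonglongrightarrow> target"
      using mean_average_tendsto[OF assms(2)] unfolding E_def by (rule filterlim_compose[rotated])
    from tendsto_add[OF dev this] have "(\<lambda>r. S (?s r) \<omega> / real (?s r)) \<longlonglongrightarrow> target"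
      by (simp add: add_divide_distrib[symmetric] del: of_nat_power of_nat_Suc)
    moreover have S_eq: "S k \<omega> = (\<Sum>t=0..k. real (C t \<omega>))" for k by (simp add: S_def sum_C_eq)
    have "mono (\<lambda>k. S k \<omega>)" unfolding S_eq by (intro monoI sum_mono2) auto
    moreover have "0 \<le> S k \<omega>" for k unfolding S_eq by (intro sum_nonneg) simp
    ultimately have "(\<lambda>k. S k \<omega> / real k) \<longlonglongrightarrow> target"
      by (intro tendsto_average_from_squares)
    then show ?case by (simp add: S_eq)
  qed
qed

end

theorem theorem3p2:
  fixes M :: "'w measure" and \<Delta> F b q :: real and f :: "real \<Rightarrow> real" and n :: nat
    and D :: "nat pmf" and B :: "nat \<Rightarrow> 'w \<Rightarrow> nat"
    and ins :: "nat \<Rightarrow> nat \<Rightarrow> 'w \<Rightarrow> bool" and ret :: "nat \<Rightarrow> nat \<Rightarrow> nat \<Rightarrow> 'w \<Rightarrow> bool"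
    and C :: "nat \<Rightarrow> 'w \<Rightarrow> nat"
  assumes "\<Delta> > 0"
    and "decay_function \<Delta> f"
    and "summable (\<lambda>i. f (real i * \<Delta>))"
    and "F = (\<Sum>i. f (real i * \<Delta>))"
    and "n \<ge> 1"
    and "integrable (measure_pmf D) real"
    and "b = measure_pmf.expectation D real"
    and "b \<ge> real n / F"
    and "q = real n / (b * F)"
    and "T_TBS M \<Delta> f q D B ins ret"
    and "C = sample_size B ins ret"
  shows
    "(\<forall>m. \<exists>k. \<P>(\<omega> in M. C k \<omega> \<ge> m) > 0)
     \<and>
     (max_batch_size D < \<infinity> \<and> summable (\<lambda>i. real i * f (real i * \<Delta>)) \<longrightarrow>
       (\<forall>m \<ge> least_recurring_size \<Delta> f q D. \<P>(\<omega> in M. \<exists>\<^sub>\<infinity>k. C k \<omega> = m) = 1))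
     \<and>
     (max_batch_size D < \<infinity> \<and>
      (\<exists>g :: nat \<Rightarrow> real. g \<longlonglongrightarrow> 0 \<and>
         (\<forall>k\<ge>1. (SUP i. f (real (i + k) * \<Delta>) / f (real i * \<Delta>)) \<le> g k)) \<longrightarrow>
       (\<forall>m \<ge> least_recurring_size \<Delta> f q D.
          (SUP j. \<integral>\<^sup>+ \<omega>. ennreal_of_enat
             (visit_time (\<lambda>k. C k \<omega>) m (Suc j) - visit_time (\<lambda>k. C k \<omega>) m j) \<partial>M) < \<infinity>)
       \<and>
       (AE \<omega> in M. (\<lambda>k. (1 / real k) * (\<Sum>i=0..k. real (C i \<omega>))) \<longlonglongrightarrow> real n))"
proof -
  interpret T_TBS M \<Delta> f q D B ins ret by fact
  have f_0: "f 0 = 1" and f_pos: "0 < f (real i * \<Delta>)" for i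
    using \<open>decay_function \<Delta> f\<close> by (auto simp: decay_function_def)
  have "sum (\<lambda>i. f (real i * \<Delta>)) {0} \<le> F"
    unfolding \<open>F = _\<close> using f_pos by (intro sum_le_suminf assms(3)) (auto intro: less_imp_le)
  then have F: "0 < F" by (simp add: f_0)
  have n: "0 < real n" using \<open>n \<ge> 1\<close> by simp
  then have "0 < real n / F" using F by simp
  then have b: "0 < b" using \<open>b \<ge> real n / F\<close> by linarith
  interpret decaying_sample M \<Delta> f q D B ins ret
  proof
    show "0 < q" unfolding \<open>q = _\<close> using n b F by simp
    have "real n \<le> b * F" using \<open>b \<ge> real n / F\<close> F by (simp add: pos_divide_le_eq)
    then show "q \<le> 1" unfolding \<open>q = _\<close> using b F by simp
    \<comment> \<open>The mean \<open>b\<close> is positive because it is at least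
      \<open>real n / F\<close>, so the sizes are not concentrated at 0.\<close>
    show "\<exists>s\<in>set_pmf D. 0 < s"
    proof (rule ccontr)
      assume "\<not> (\<exists>s\<in>set_pmf D. 0 < s)"
      then have "measure_pmf.expectation D real = measure_pmf.expectation D (\<lambda>_. 0)"
        by (intro integral_cong_AE) (auto simp: AE_measure_pmf_iff)
      then show False using b \<open>b = _\<close> by simp
    qed
  qed fact+
  have "target = q * b * F"
    by (simp only: target_def mean_size_def \<open>b = _\<close> \<open>F = _\<close>)
  then have target: "target = real n"
    using b F \<open>q = _\<close> by simp
  show ?thesis
    unfolding \<open>C = _\<close>
  proof (intro conjI impI allI)
    show "\<exists>k. \<P>(\<omega> in M. m \<le> sample_size B ins ret k \<omega>) > 0" for m
      by (rule prob_C_ge_pos)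
    show "\<P>(\<omega> in M. \<exists>\<^sub>\<infinity>k. sample_size B ins ret k \<omega> = m) = 1"
      if "least_recurring_size \<Delta> f q D \<le> m" for m
      using that by (rule prob_infinitely_often)
  next
    assume *: "max_batch_size D < \<infinity> \<and> (\<exists>g :: nat \<Rightarrow> real. g \<longlonglongrightarrow> 0 \<and>
      (\<forall>k\<ge>1. (SUP i. f (real (i + k) * \<Delta>) / f (real i * \<Delta>)) \<le> g k))"
    then have contracting using contractingI by blast
    then show "(SUP j. \<integral>\<^sup>+ \<omega>. ennreal_of_enat
        (visit_time (\<lambda>k. sample_size B ins ret k \<omega>) m (Suc j) - visit_time (\<lambda>k. sample_size B ins ret k \<omega>) m j) \<partial>M) < \<infinity>"
      if "least_recurring_size \<Delta> f q D \<le> m" for m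
      using that by (rule visit_gap_bounded)
    show "AE \<omega> in M. (\<lambda>k. (1 / real k) * (\<Sum>i=0..k. real (sample_size B ins ret i \<omega>))) \<longlonglongrightarrow> real n"
      using AE_average_tendsto[OF _ \<open>contracting\<close>] * by (simp only: target)
  qed
qed

end
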